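(* Let $0<\beta\le 1$ and $\gamma>0$, and let $Z=\{Z_t:t\ge 0\}$ be a super-coalescing Brownian motion (SCBM) with branching rate $\gamma$, $(1+\beta)$-stable branching, and initial measure $Z_0(dx)=dx$ (Lebesgue measure on $\mathbb{R}$). Let $g:[0,\infty)\to[0,\infty)$ be nonnegative, nondecreasing and right continuous, and put $\tau:=\sup\{t\ge 0: Z_t([-g(t),g(t)])\neq 0\}$ (with $\sup\emptyset=0$). If \[\int_1^\infty g(y)\,y^{-1-1/\beta}\,dy<\infty,\] then $\mathbb{P}\{\tau<\infty\}=1$.
   Context: For $t,z\ge 0$ let $\psi_t(z)=z\big(\frac{1+\beta}{1+\beta+\gamma\beta t z^{\beta}}\big)^{1/\beta}$; this is the Laplace exponent of a continuous state branching process (CSBP) with $(1+\beta)$-stable branching: its transition semigroup $Q_t$ satisfies $\int_0^\infty e^{-zy}Q_t(x,dy)=e^{-x\psi_t(z)}$. A coalescing Brownian flow $\{\phi(a,t):a\in\mathbb{R},t\ge0\}$ (Arratia's flow) is a two-parameter process, continuous in $t$, nondecreasing and right continuous in $a$, such that for any $a_1,\dots,a_n$ the process $(\phi(a_1,t),\dots,\phi(a_n,t))$ is a coalescing Brownian motion started at $(a_1,\dots,a_n)$ (independent Brownian motions which move together after they meet). An SCBM with initial Radon measure $\mu$ on $\mathbb{R}$ is a Markov process taking values in purely atomic Radon measures (for $t>0$) with $X_0=\mu$ and $\mathbb{E}[\exp\{-\langle X_t,f\rangle\}]=\mathbb{E}[\exp\{-\int_{\mathbb{R}}\psi_t(f(\phi(a,t)))\mu(da)\}]$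 for all bounded Borel $f$ with bounded support and the transition semigroup given by the same formula; intuitively atoms move as coalescing Brownian motions while their masses evolve as independent CSBPs and are added upon coalescence.
   Formalization: The paths of Z are additionally assumed càdlàg in the vague topology; the definition of SCBM through its Markov semigroup alone leaves τ dependent on the choice of version, and the claim fails for modifications altered at random times. *)

theory Defs
  imports "HOL-Probability.Probability"
begin

text \<open>Laplace exponent of the (1+beta)-stable CSBP with branching rate gamma.\<close>
definition psi :: "real \<Rightarrow> real \<Rightarrow> real \<Rightarrow> real \<Rightarrow> real" where
  "psi \<beta> \<gamma> t z = z * ((1 + \<beta>) / (1 + \<beta> + \<gamma> * \<beta> * t * z powr \<beta>)) powr (1 / \<beta>)"

definition indep_BMs :: "'b measure \<Rightarrow> (nat \<Rightarrow> 'b \<Rightarrow> real \<Rightarrow> real) \<Rightarrow> real list \<Rightarrow> bool" where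
  "indep_BMs P B as \<longleftrightarrow> prob_space P \<and>
     (\<forall>i<length as. \<forall>\<omega>\<in>space P. continuous_on {0..} (B i \<omega>) \<and> B i \<omega> 0 = as ! i) \<and>
     (\<forall>i<length as. \<forall>t. (\<lambda>\<omega>. B i \<omega> t) \<in> borel_measurable P) \<and>
     (\<forall>ts::real list. sorted_wrt (<) ts \<and> ts \<noteq> [] \<and> hd ts = 0 \<longrightarrow>
        prob_space.indep_vars P (\<lambda>_. borel)
          (\<lambda>ij \<omega>. B (fst ij) \<omega> (ts ! Suc (snd ij)) - B (fst ij) \<omega> (ts ! snd ij))
          ({..<length as} \<times> {..<length ts - 1}) \<and>
        (\<forall>i<length as. \<forall>j<length ts - 1.
           distributed P lborel (\<lambda>\<omega>. B i \<omega> (ts ! Suc j) - B i \<omega> (ts ! j))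
             (normal_density 0 (sqrt (ts ! Suc j - ts ! j)))))"

definition merge_path :: "(real \<Rightarrow> real) list \<Rightarrow> (real \<Rightarrow> real) \<Rightarrow> (real \<Rightarrow> real)" where
  "merge_path xs b =
     (let S = {t. 0 \<le> t \<and> (\<exists>x\<in>set xs. b t = x t)} in
      if S = {} then b else
        (let T = Inf S; j = (LEAST j. j < length xs \<and> b T = (xs ! j) T) in
          (\<lambda>t. if t < T then b t else (xs ! j) t)))"

definition coal_paths :: "(real \<Rightarrow> real) list \<Rightarrow> (real \<Rightarrow> real) list" where
  "coal_paths bs = foldl (\<lambda>xs b. xs @ [merge_path xs b]) [] bs"

definition arratia_flow :: "'b measure \<Rightarrow> ('b \<Rightarrow> real \<Rightarrow> real \<Rightarrow> real) \<Rightarrow> bool" where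
  "arratia_flow N \<phi> \<longleftrightarrow> prob_space N \<and>
     (\<forall>\<omega>\<in>space N. \<forall>a. continuous_on {0..} (\<phi> \<omega> a)) \<and>
     (\<forall>\<omega>\<in>space N. \<forall>t\<ge>0. mono (\<lambda>a. \<phi> \<omega> a t) \<and>
        (\<forall>a. continuous (at_right a) (\<lambda>a. \<phi> \<omega> a t))) \<and>
     (\<forall>a t. (\<lambda>\<omega>. \<phi> \<omega> a t) \<in> borel_measurable N) \<and>
     (\<forall>(as::real list) (ts::real list). (\<forall>t\<in>set ts. 0 \<le> t) \<longrightarrow>
        (\<exists>(P :: (nat \<Rightarrow> real \<Rightarrow> real) measure) B. indep_BMs P B as \<and>
           distr N (Pi\<^sub>M ({..<length as} \<times> {..<length ts}) (\<lambda>_. borel))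
             (\<lambda>\<omega>. \<lambda>x\<in>{..<length as} \<times> {..<length ts}. \<phi> \<omega> (as ! fst x) (ts ! snd x))
         = distr P (Pi\<^sub>M ({..<length as} \<times> {..<length ts}) (\<lambda>_. borel))
             (\<lambda>\<omega>. \<lambda>x\<in>{..<length as} \<times> {..<length ts}.
                (coal_paths (map (\<lambda>i. B i \<omega>) [0..<length as]) ! fst x) (ts ! snd x))))"

definition scbm_laplace :: "real \<Rightarrow> real \<Rightarrow> 'b measure \<Rightarrow> ('b \<Rightarrow> real \<Rightarrow> real \<Rightarrow> real)
    \<Rightarrow> real \<Rightarrow> (real \<Rightarrow> real) \<Rightarrow> real measure \<Rightarrow> real" where
  "scbm_laplace \<beta> \<gamma> N \<phi> t f \<mu> =
     (\<integral>\<omega>. exp (- (\<integral>a. psi \<beta> \<gamma> t (f (\<phi> \<omega> a t)) \<partial>\<mu>)) \<partial>N)"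

definition nat_filtration :: "'a measure \<Rightarrow> (real \<Rightarrow> 'a \<Rightarrow> real measure) \<Rightarrow> real \<Rightarrow> 'a measure" where
  "nat_filtration M Z s = sigma (space M)
     {(\<lambda>\<omega>. emeasure (Z r \<omega>) B) -` U \<inter> space M | r B U.
        0 \<le> r \<and> r \<le> s \<and> B \<in> sets borel \<and> U \<in> sets (borel :: ennreal measure)}"

definition test_fun :: "(real \<Rightarrow> real) \<Rightarrow> bool" where
  "test_fun f \<longleftrightarrow> f \<in> borel_measurable borel \<and> bounded (range f) \<and> (\<forall>x. 0 \<le> f x)
     \<and> bounded {x. f x \<noteq> 0}"

definition cadlag_on_nonneg :: "(real \<Rightarrow> real) \<Rightarrow> bool" where
  "cadlag_on_nonneg h \<longleftrightarrow> (\<forall>t\<ge>0. continuous (at_right t) h \<and> (0 < t \<longrightarrow> (\<exists>l. (h \<longlongrightarrow> l) (at_left t))))"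

definition scbm :: "real \<Rightarrow> real \<Rightarrow> 'b measure \<Rightarrow> ('b \<Rightarrow> real \<Rightarrow> real \<Rightarrow> real)
    \<Rightarrow> 'a measure \<Rightarrow> (real \<Rightarrow> 'a \<Rightarrow> real measure) \<Rightarrow> real measure \<Rightarrow> bool" where
  "scbm \<beta> \<gamma> N \<phi> M Z \<mu> \<longleftrightarrow> prob_space M \<and>
     (\<forall>t\<ge>0. \<forall>\<omega>\<in>space M. sets (Z t \<omega>) = sets borel \<and>
        (\<forall>K. compact K \<longrightarrow> emeasure (Z t \<omega>) K < \<infinity>)) \<and>
     (\<forall>\<omega>\<in>space M. Z 0 \<omega> = \<mu>) \<and>
     (\<forall>t>0. AE \<omega> in M. \<exists>A. countable A \<and> emeasure (Z t \<omega>) (UNIV - A) = 0) \<and>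
     (\<forall>t\<ge>0. \<forall>B\<in>sets borel. (\<lambda>\<omega>. emeasure (Z t \<omega>) B) \<in> borel_measurable M) \<and>
     (\<forall>\<omega>\<in>space M. \<forall>f. continuous_on UNIV f \<and> (\<forall>x. 0 \<le> f x) \<and> bounded {x. f x \<noteq> 0} \<longrightarrow>
        cadlag_on_nonneg (\<lambda>t. \<integral>x. f x \<partial>(Z t \<omega>))) \<and>
     (\<forall>s\<ge>0. \<forall>t\<ge>0. \<forall>f. test_fun f \<longrightarrow>
        (\<forall>A\<in>sets (nat_filtration M Z s).
           (\<integral>\<omega>\<in>A. exp (- (\<integral>x. f x \<partial>(Z (s + t) \<omega>))) \<partial>M)
           = (\<integral>\<omega>\<in>A. scbm_laplace \<beta> \<gamma> N \<phi> t f (Z s \<omega>) \<partial>M)))"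

end

theory Submission
  imports Defs "HOL-Real_Asymp.Real_Asymp"
begin

text \<open>
  Put $p = 1/\beta$ and $\kappa = \gamma\beta/(1+\beta)$, so that $\psi_r(w^{-p}) = (w + \kappa r)^{-p}$.
  For small $D > 0$ the function $v(x) = (D\,(|x|-R)_+^2 + \eta)^{-p}$ is a supersolution,
  $E\,\psi_r(v(x + B_r)) \le v(x)$; it is a bounded version of the stationary blow-up solution
  of the log-Laplace equation of super-Brownian motion. By Jensen's inequality, only the
  one-point motion of the flow matters, and $1 - \exp(-\langle Z_t, v\rangle)$ is a supermartingale.
  Its value is close to $1$ as soon as $Z_t$ charges $[-R,R]$ and $\eta$ is small, while
  its mean at time $s$ is at most $\int \psi_s(v(x))\,dx = O((R + \sqrt s)\, s^{-p})$ uniformly in $\eta$.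
  The maximal inequality bounds the probability that $Z$ ever charges $[-R,R]$ after time $s$,
  and Borel--Cantelli with $s = 2^n$, $R = g(2^{n+1})$ concludes; $p \ge 1$ makes
  $\sum_n 2^{n/2} 2^{-np}$ converge.
\<close>

text \<open>The process is accessible only through its transition Laplace formula, so the
  supersolution inequality is proved for every time step \<open>r > 0\<close> by a direct Gaussian
  estimate instead of a generator computation. Three obstacles shape the rest. The blow-up solution
  itself is infinite on the interval, so \<open>\<eta> > 0\<close> is kept and every probability
  bound is made independent of it; letting the height of the barrier tend to infinity then detects
  arbitrarily small masses. The Laplace formula is given only for test functions of bounded support,
  whereas the barrier is positive everywhere, so it is truncated and its integral may be infinite.
  Finally, path regularity is given only for integrals of continuous functions of bounded support,
  so charging an interval is read off from a slightly wider continuous function, first at dyadic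
  times and then at all times by right continuity.\<close>

section \<open>Elementary bounds for negative powers\<close>

lemma powr_ge_linear:
  fixes p h :: real
  assumes p: "1 \<le> p" and h: "0 \<le> 1 + p * h"
  shows "1 + p * h \<le> (1 + h) powr p"
proof (cases "1 + p * h = 0")
  case False
  \<comment> \<open>Weighted AM-GM for \<open>1 + p * h\<close> and \<open>1\<close> with weights
    \<open>1 / p\<close> and \<open>1 - 1 / p\<close>, whose weighted mean is \<open>1 + h\<close>.
    This yields Bernoulli's inequality for a real exponent.\<close>
  have "(1 + p * h) powr (1 / p) * 1 powr (1 - 1 / p) \<le> 1 / p * (1 + p * h) + (1 - 1 / p) * 1"
    by (rule Youngs_inequality_0) (use p h False in \<open>auto simp: field_simps\<close>)
  also have "\<dots> = 1 + h" using p by (simp add: field_simps)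
  finally have "(1 + p * h) powr (1 / p) \<le> 1 + h" by simp
  then have "((1 + p * h) powr (1 / p)) powr p \<le> (1 + h) powr p"
    using p by (intro powr_mono2) auto
  then show ?thesis using p h by (simp add: powr_powr)
qed simp

text \<open>Bernoulli replaces the power by \<open>1 / (1 + p * h)\<close>. Multiplying out, the
  surplus of the quadratic is a square times \<open>1 + 2 * p * h\<close>, which is where the
  threshold \<open>- 1 / 2\<close> comes from.\<close>

lemma powr_minus_le_quadratic:
  fixes p h :: real
  assumes p: "1 \<le> p" and h: "- 1 / 2 \<le> p * h"
  shows "(1 + h) powr (- p) \<le> 1 - p * h + 2 * p\<^sup>2 * h\<^sup>2"
proof -
  have pos: "1 / 2 \<le> 1 + p * h" using h by simp
  have "(1 + h) powr (- p) \<le> 1 / (1 + p * h)"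
    using powr_ge_linear[OF p, of h] pos by (simp add: powr_minus_divide frac_le)
  also have "1 / (1 + p * h) \<le> 1 - p * h + 2 * p\<^sup>2 * h\<^sup>2"
  proof -
    have "(1 - p * h + 2 * p\<^sup>2 * h\<^sup>2) * (1 + p * h) - 1 = (p * h)\<^sup>2 * (2 * (1 + p * h) - 1)"
      by (simp add: algebra_simps power2_eq_square)
    also have "\<dots> \<ge> 0" using pos by simp
    finally show ?thesis using pos by (simp add: divide_le_eq)
  qed
  finally show ?thesis .
qed

text \<open>The linear term has mean zero for centred Gaussian \<open>q\<close>; the high moment absorbs the
  singularity \<open>e powr (- p)\<close> on the rare event where \<open>1 + q\<close> is not bounded away from zero.\<close>
lemma shifted_powr_minus_le:
  fixes p e q :: real
  assumes p: "1 \<le> p" and e: "0 < e" "e \<le> 1"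
  shows "(max 0 (1 + q) + e) powr (- p)
    \<le> 1 - e / 2 - p * (1 + e) powr (- p - 1) * q + 2 * p\<^sup>2 * q\<^sup>2 + e powr (- p) * (2 * p * q) ^ (2 * k)"
proof (cases "- 1 / 2 \<le> p * q")
  case True
  \<comment> \<open>Dividing by \<open>1 + e\<close> isolates the deterministic shift in the factor
    \<open>A\<close>; its bound \<open>1 - e / 2\<close> is the gain that later pays for all error
    terms.\<close>
  define h where "h = q / (1 + e)"
  define A where "A = (1 + e) powr (- p)"
  have q: "q = h * (1 + e)" using e by (simp add: h_def)
  have q1: "-1 < q" 
  proof (rule ccontr)
    assume "\<not> -1 < q"
    then have "p * q \<le> 1 * (-1)" using p mult_mono[of 1 p 1 "-q"] by simp
    with True show False by simp
  qed
  have ph: "- 1 / 2 \<le> p * h"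
  proof (cases "0 \<le> q")
    case True then show ?thesis using p e by (simp add: h_def order_trans[of _ 0])
  next
    case False
    have "p * q \<le> p * q / (1 + e)" using False p e by (simp add: le_divide_eq mult_le_0_iff distrib_left)
    then show ?thesis using True by (simp add: h_def)
  qed
  have "max 0 (1 + q) + e = (1 + e) * (1 + h)" using q1 e by (simp add: h_def field_simps)
  moreover have "0 \<le> 1 + h" using q1 e by (simp add: h_def field_simps)
  ultimately have "(max 0 (1 + q) + e) powr (- p) = A * (1 + h) powr (- p)"
    using q1 e by (simp add: powr_mult A_def)
  also have "\<dots> \<le> A * (1 - p * h + 2 * p\<^sup>2 * h\<^sup>2)"
    by (intro mult_left_mono powr_minus_le_quadratic p ph) (simp add: A_def)
  also have "\<dots> = A - p * (A * h) + A * (2 * p\<^sup>2 * h\<^sup>2)" by (simp add: algebra_simps)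
  also have "A * h = (1 + e) powr (- p - 1) * q"
    using e by (simp add: A_def h_def powr_diff)
  also have "A * (2 * p\<^sup>2 * h\<^sup>2) \<le> 1 * (2 * p\<^sup>2 * q\<^sup>2)"
  proof (intro mult_mono mult_left_mono)
    show "A \<le> 1" using e p powr_mono[of "-p" 0 "1+e"] by (simp add: A_def)
    have "\<bar>h\<bar> \<le> \<bar>q\<bar>" using e by (simp add: h_def abs_divide divide_le_eq mult_le_cancel_left1 distrib_left)
    then show "h\<^sup>2 \<le> q\<^sup>2" by (simp add: abs_le_square_iff)
  qed (auto simp: A_def)
  also have "A \<le> 1 - e / 2"
  proof -
    have "A \<le> (1 + e) powr (-1)" unfolding A_def using e p by (intro powr_mono) auto
    also have "\<dots> = 1 / (1 + e)" using e by (simp add: powr_minus_divide)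
    also have "\<dots> \<le> 1 - e / 2"
    proof -
      have "(1 - e / 2) * (1 + e) - 1 = e / 2 * (1 - e)" by (simp add: field_simps)
      also have "\<dots> \<ge> 0" using e by simp
      finally show ?thesis using e by (simp add: divide_le_eq)
    qed
    finally show ?thesis .
  qed
  finally have "(max 0 (1 + q) + e) powr (- p)
    \<le> 1 - e / 2 - p * (1 + e) powr (- p - 1) * q + 2 * p\<^sup>2 * q\<^sup>2" by simp
  moreover have "0 \<le> e powr (- p) * (2 * p * q) ^ (2 * k)"
    by (simp add: power_mult)
  ultimately show ?thesis by linarith
next
  case False
  then have "1\<^sup>2 \<le> (- (2 * p * q))\<^sup>2" by (intro power_mono) auto
  then have pq: "1 \<le> (2 * p * q)\<^sup>2" by simp
  have q0: "q \<le> 0" 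
  proof (rule ccontr)
    assume "\<not> q \<le> 0"
    then have "0 \<le> p * q" using p by simp
    then show False using False by linarith
  qed
  have "(max 0 (1 + q) + e) powr (- p) \<le> e powr (- p)"
    using e p by (intro powr_mono2') auto
  also have "\<dots> \<le> e powr (- p) * (2 * p * q) ^ (2 * k)"
    using one_le_power[OF pq, of k] by (simp add: power_mult mult_le_cancel_left1)
  finally have "(max 0 (1 + q) + e) powr (- p) \<le> e powr (- p) * (2 * p * q) ^ (2 * k)" .
  \<comment> \<open>On this event \<open>q\<close> is negative, so the linear term has the
    favourable sign and can be added for free.\<close>
  moreover have "0 \<le> - (p * (1 + e) powr (- p - 1) * q)"
    using q0 p by (simp add: mult_le_0_iff)
  moreover have "0 \<le> 2 * p\<^sup>2 * q\<^sup>2" by simp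
  ultimately show ?thesis using e by linarith
qed

section \<open>The Gaussian average of a shifted negative power\<close>

text \<open>Integrating the pointwise bound gives \<open>1 - e / 2\<close> plus errors of order
  \<open>c\<^sup>2 * r\<close> and \<open>e powr (- p) * (c\<^sup>2 * r) ^ k\<close>. Under the
  hypothesis on \<open>c\<close> the second is of order
  \<open>\<delta> ^ k * e powr (k - p)\<close>, and \<open>k \<ge> p + 1\<close> leaves a full
  factor \<open>e\<close> after the singularity is absorbed. Both errors are then of order
  \<open>\<delta> * e\<close> and a small \<open>\<delta>\<close> keeps them below
  \<open>e / 2\<close>.\<close>

lemma gaussian_powr_minus_le_one:
  fixes p :: real
  assumes p: "1 \<le> p"
  shows "\<exists>\<delta>>0. \<forall>r c e. 0 < r \<longrightarrow> 0 < e \<longrightarrow> c\<^sup>2 * r \<le> \<delta> * e \<longrightarrow>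
      (\<integral>\<^sup>+b. ennreal (normal_density 0 (sqrt r) b) * ennreal ((max 0 (1 + c * b) + e) powr (- p)) \<partial>lborel) \<le> 1"
proof -
  obtain k :: nat where k: "p + 1 \<le> real k" using real_arch_simple by blast
  \<comment> \<open>The moment of order \<open>2 * k\<close> of a centred Gaussian of variance
    \<open>r\<close> is \<open>m * r ^ k\<close>. \<open>A\<close> collects the coefficients of
    \<open>\<delta> * e\<close>, and \<open>\<delta> \<le> 1\<close> allows
    \<open>\<delta> ^ k \<le> \<delta>\<close>.\<close>
  define m :: real where "m = fact (2 * k) / (2 ^ k * fact k)"
  define A where "A = 2 * p\<^sup>2 + (2 * p) ^ (2 * k) * m"
  have m: "0 < m" by (simp add: m_def)
  have A: "0 < A" using p m by (simp add: A_def add_pos_pos)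
  define \<delta> where "\<delta> = min 1 (1 / (2 * A))"
  have \<delta>: "0 < \<delta>" "\<delta> \<le> 1" "A * \<delta> \<le> 1 / 2"
    using A by (auto simp: \<delta>_def min_def field_simps)
  show ?thesis
  proof (intro exI[of _ \<delta>] conjI allI impI \<delta>(1))
    fix r c e :: real assume r: "0 < r" and e: "0 < e" and c: "c\<^sup>2 * r \<le> \<delta> * e"
    let ?n = "normal_density 0 (sqrt r)"
    let ?f = "\<lambda>b. (max 0 (1 + c * b) + e) powr (- p)"
    have m0: "has_bochner_integral lborel ?n 1"
      using normal_moment_even[of "sqrt r" 0 0] r by simp
    show "(\<integral>\<^sup>+b. ennreal (?n b) * ennreal (?f b) \<partial>lborel) \<le> 1"
    proof (cases "e \<le> 1")
      \<comment> \<open>For \<open>e > 1\<close> the base exceeds 1 for every \<open>b\<close>, so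
        the density alone dominates.\<close>
      case False
      have "(\<integral>\<^sup>+b. ennreal (?n b) * ennreal (?f b) \<partial>lborel) \<le> (\<integral>\<^sup>+b. ennreal (?n b) \<partial>lborel)"
      proof (intro nn_integral_mono)
        fix b
        have "?f b \<le> 1 powr (- p)" using False p by (intro powr_mono2') auto
        then have "?n b * ?f b \<le> ?n b * 1" by (intro mult_left_mono) auto
        then show "ennreal (?n b) * ennreal (?f b) \<le> ennreal (?n b)"
          by (simp add: ennreal_mult[symmetric])
      qed
      also have "\<dots> = ennreal 1"
        using m0 by (intro nn_integral_eq_integral[THEN trans])
          (auto simp: has_bochner_integral_iff)
      finally show ?thesis by simp
    next
      case True
      let ?B = "p * (1 + e) powr (- p - 1)"
      let ?g = "\<lambda>b. (1 - e / 2) * ?n b - ?B * c * (?n b * b) + 2 * p\<^sup>2 * c\<^sup>2 * (?n b * b\<^sup>2)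
        + e powr (- p) * (2 * p * c) ^ (2 * k) * (?n b * b ^ (2 * k))"
      let ?G = "(1 - e / 2) * 1 - ?B * c * 0 + 2 * p\<^sup>2 * c\<^sup>2 * r
        + e powr (- p) * (2 * p * c) ^ (2 * k) * (m * r ^ k)"
      have m1: "has_bochner_integral lborel (\<lambda>b. ?n b * b) 0"
        using normal_moment_odd[of "sqrt r" 0 0] r by simp
      have m2: "has_bochner_integral lborel (\<lambda>b. ?n b * b\<^sup>2) r"
        using normal_moment_even[of "sqrt r" 0 1] r by (simp add: numeral_2_eq_2)
      have m3: "has_bochner_integral lborel (\<lambda>b. ?n b * b ^ (2 * k)) (m * r ^ k)"
        using normal_moment_even[of "sqrt r" 0 k] r by (simp add: m_def power_divide)
      have G: "has_bochner_integral lborel ?g ?G"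
        by (intro has_bochner_integral_add has_bochner_integral_diff has_bochner_integral_mult_right m0 m1 m2 m3)
      have le: "?n b * ?f b \<le> ?g b" for b
      proof -
        have "?n b * ?f b \<le> ?n b * (1 - e / 2 - ?B * (c * b) + 2 * p\<^sup>2 * (c * b)\<^sup>2
            + e powr (- p) * (2 * p * (c * b)) ^ (2 * k))"
          by (intro mult_left_mono shifted_powr_minus_le p e True) auto
        also have "\<dots> = ?g b" by (simp add: algebra_simps power_mult_distrib)
        finally show ?thesis .
      qed
      have "(\<integral>\<^sup>+b. ennreal (?n b) * ennreal (?f b) \<partial>lborel) \<le> (\<integral>\<^sup>+b. ennreal (?g b) \<partial>lborel)"
        using le by (intro nn_integral_mono) (simp add: ennreal_mult[symmetric] ennreal_leI)
      also have "\<dots> = ennreal ?G"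
      proof (subst nn_integral_eq_integral)
        show "AE b in lborel. 0 \<le> ?g b"
          by (intro AE_I2 order_trans[OF _ le]) auto
      qed (use G in \<open>auto simp: has_bochner_integral_iff\<close>)
      also have "?G \<le> 1"
      proof -
        have "(c\<^sup>2 * r) ^ k \<le> (\<delta> * e) ^ k" using c r by (intro power_mono) auto
        also have "\<dots> = \<delta> ^ k * e powr k" using e by (simp add: power_mult_distrib powr_realpow)
        finally have "e powr (- p) * (c\<^sup>2 * r) ^ k \<le> e powr (- p) * (\<delta> ^ k * e powr k)"
          by (intro mult_left_mono) auto
        also have "\<dots> = \<delta> ^ k * e powr (k - p)" using e by (simp add: powr_add[symmetric])
        also have "\<dots> \<le> \<delta> ^ 1 * e powr 1"
          using \<delta> e True k p by (intro mult_mono power_decreasing powr_mono') auto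
        finally have 1: "e powr (- p) * (c\<^sup>2 * r) ^ k \<le> \<delta> * e" using e by simp
        have "?G = 1 - e / 2 + 2 * p\<^sup>2 * (c\<^sup>2 * r) + (2 * p) ^ (2 * k) * m * (e powr (- p) * (c\<^sup>2 * r) ^ k)"
          by (simp add: power_mult_distrib power_mult[symmetric])
        also have "\<dots> \<le> 1 - e / 2 + 2 * p\<^sup>2 * (\<delta> * e) + (2 * p) ^ (2 * k) * m * (\<delta> * e)"
          using 1 c m p by (intro add_mono mult_left_mono) auto
        also have "\<dots> = 1 - e / 2 + (A * \<delta>) * e" by (simp add: A_def algebra_simps)
        also have "\<dots> \<le> 1" using mult_right_mono[OF \<delta>(3), of e] e by simp
        finally show ?thesis .
      qed
      finally show ?thesis by (simp add: ennreal_leI)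
    qed
  qed
qed

section \<open>The barrier and its supersolution property\<close>

definition barrier :: "real \<Rightarrow> real \<Rightarrow> real \<Rightarrow> real \<Rightarrow> real \<Rightarrow> real" where
  "barrier p D R \<eta> x = (D * (max 0 (\<bar>x\<bar> - R))\<^sup>2 + \<eta>) powr (- p)"

lemma barrier_nonneg [simp]: "0 \<le> barrier p D R \<eta> x"
  by (simp add: barrier_def)

lemma barrier_measurable [measurable]: "barrier p D R \<eta> \<in> borel_measurable borel"
  unfolding barrier_def[abs_def] by measurable

lemma barrier_le: "0 \<le> p \<Longrightarrow> 0 < D \<Longrightarrow> 0 < \<eta> \<Longrightarrow> barrier p D R \<eta> x \<le> \<eta> powr (- p)"
  unfolding barrier_def by (intro powr_mono2') auto

lemma barrier_eq: "\<bar>x\<bar> \<le> R \<Longrightarrow> barrier p D R \<eta> x = \<eta> powr (- p)"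
  by (simp add: barrier_def)

text \<open>\<open>psi\<close> is the flow of
  \<open>u' = - (\<gamma> / (1 + \<beta>)) * u powr (1 + \<beta>)\<close>, along which
  \<open>u powr (- \<beta>)\<close> grows linearly with slope
  \<open>\<gamma> * \<beta> / (1 + \<beta>)\<close>. Branching therefore stays within the family of
  barriers and only raises \<open>\<eta>\<close>.\<close>

lemma psi_barrier:
  assumes \<beta>: "0 < \<beta>" and \<gamma>: "0 < \<gamma>" and D: "0 < D" and \<eta>: "0 < \<eta>" and t: "0 \<le> t"
  shows "psi \<beta> \<gamma> t (barrier (1 / \<beta>) D R \<eta> x) = barrier (1 / \<beta>) D R (\<eta> + \<gamma> * \<beta> / (1 + \<beta>) * t) x"
proof -
  define W where "W = D * (max 0 (\<bar>x\<bar> - R))\<^sup>2 + \<eta>"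
  have W: "0 < W" using D \<eta> by (simp add: W_def add_nonneg_pos)
  have eq: "barrier (1 / \<beta>) D R \<eta> x = W powr (- 1 / \<beta>)" by (simp add: barrier_def W_def)
  have z: "(W powr (- 1 / \<beta>)) powr \<beta> = 1 / W"
    using W \<beta> by (simp add: powr_powr)
  have "(1 + \<beta>) / (1 + \<beta> + \<gamma> * \<beta> * t * (1 / W)) = W / (W + \<gamma> * \<beta> / (1 + \<beta>) * t)"
    using W \<beta> by (simp add: field_simps)
  then have "psi \<beta> \<gamma> t (W powr (- 1 / \<beta>)) = W powr (- 1 / \<beta>) * (W / (W + \<gamma> * \<beta> / (1 + \<beta>) * t)) powr (1 / \<beta>)"
    unfolding psi_def z by simp
  also have "\<dots> = (W + \<gamma> * \<beta> / (1 + \<beta>) * t) powr (- 1 / \<beta>)"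
    using W \<beta> \<gamma> t by (simp add: powr_divide powr_minus_divide)
  finally show ?thesis by (simp add: eq) (simp add: barrier_def W_def add.assoc)
qed

text \<open>Convexity: as a function of \<open>b\<close> the left side is a supporting line of the
  right side at \<open>b = 0\<close>. Multiply the one-sided bound for \<open>m (x + b)\<close> by
  \<open>m x\<close> and expand the square of the increment.\<close>

lemma sq_dist_interval_ge_tangent:
  fixes x b R :: real
  defines "m \<equiv> \<lambda>y. max 0 (\<bar>y\<bar> - R)"
  shows "(m x)\<^sup>2 + 2 * sgn x * m x * b \<le> (m (x + b))\<^sup>2"
proof (cases "m x = 0")
  case False
  then have mx: "0 < m x" "m x = \<bar>x\<bar> - R" by (auto simp: m_def max_def split: if_splits)
  have "m x + sgn x * b \<le> m (x + b)"
    using mx by (auto simp: m_def sgn_if max_def split: if_splits)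
  then have "m x * (m x + sgn x * b) \<le> m x * m (x + b)" using mx by (intro mult_left_mono) auto
  moreover have "0 \<le> (m (x + b) - m x)\<^sup>2" by simp
  ultimately show ?thesis by (simp add: power2_eq_square algebra_simps)
qed simp

text \<open>Dividing by the base \<open>W\<close> at \<open>x\<close> turns the claim into the
  Gaussian estimate with relative slope \<open>c\<close> and relative branching gain
  \<open>e\<close>. For a quadratic profile \<open>c\<^sup>2 \<le> 4 * D / W\<close>, while
  \<open>e / r = \<kappa> / W\<close>; the same scaling in \<open>W\<close> is why one
  \<open>D\<close> serves all \<open>R\<close>, \<open>\<eta>\<close>, \<open>r\<close> and
  \<open>x\<close>.\<close>

lemma barrier_supersolution:
  fixes p \<kappa> :: real
  assumes p: "1 \<le> p" and \<kappa>: "0 < \<kappa>"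
  shows "\<exists>D>0. \<forall>R \<eta> r x. 0 < \<eta> \<longrightarrow> 0 < r \<longrightarrow>
      (\<integral>\<^sup>+b. ennreal (normal_density 0 (sqrt r) b) * ennreal (barrier p D R (\<eta> + \<kappa> * r) (x + b)) \<partial>lborel)
      \<le> ennreal (barrier p D R \<eta> x)"
proof -
  obtain \<delta> where \<delta>: "0 < \<delta>" and gauss:
    "\<And>r c e. 0 < r \<Longrightarrow> 0 < e \<Longrightarrow> c\<^sup>2 * r \<le> \<delta> * e \<Longrightarrow>
      (\<integral>\<^sup>+b. ennreal (normal_density 0 (sqrt r) b) * ennreal ((max 0 (1 + c * b) + e) powr (- p)) \<partial>lborel) \<le> 1"
    using gaussian_powr_minus_le_one[OF p] by auto
  \<comment> \<open>Chosen so that \<open>4 * D / W * r\<close> equals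
    \<open>\<delta> * e\<close>.\<close>
  define D where "D = \<delta> * \<kappa> / 4"
  have D: "0 < D" using \<delta> \<kappa> by (simp add: D_def)
  show ?thesis
  proof (intro exI[of _ D] conjI allI impI D)
    fix R \<eta> r x :: real assume \<eta>: "0 < \<eta>" and r: "0 < r"
    define m where "m = (\<lambda>y. max 0 (\<bar>y\<bar> - R))"
    define W where "W = D * (m x)\<^sup>2 + \<eta>"
    define c where "c = 2 * D * sgn x * m x / W"
    define e where "e = \<kappa> * r / W"
    have W: "0 < W" using D \<eta> by (simp add: W_def add_nonneg_pos)
    have e: "0 < e" using W \<kappa> r by (simp add: e_def)
    have c: "c\<^sup>2 * r \<le> \<delta> * e"
    proof -
      have "(2 * D * sgn x * m x)\<^sup>2 = 4 * D * (D * (m x)\<^sup>2 * (sgn x)\<^sup>2)"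
        by (simp add: power_mult_distrib power2_eq_square)
      also have "\<dots> \<le> 4 * D * (D * (m x)\<^sup>2 * 1)"
        using D by (intro mult_left_mono) (auto simp: sgn_if)
      also have "\<dots> \<le> 4 * D * W" using D \<eta> by (intro mult_left_mono) (auto simp: W_def)
      finally have "c\<^sup>2 \<le> 4 * D * W / W\<^sup>2" by (simp add: c_def power_divide divide_right_mono)
      also have "\<dots> = 4 * D / W" using W by (simp add: power2_eq_square)
      finally have "c\<^sup>2 * r \<le> 4 * D / W * r" using r by (intro mult_right_mono) auto
      then show ?thesis by (simp add: e_def D_def)
    qed
    \<comment> \<open>Bounding the convex \<open>D * (m y)\<^sup>2 + \<eta>\<close> below by its tangent at \<open>x\<close> leaves an affine function of \<open>b\<close>.\<close>
    have le: "barrier p D R (\<eta> + \<kappa> * r) (x + b) \<le> barrier p D R \<eta> x * (max 0 (1 + c * b) + e) powr (- p)" for b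
    proof -
      have "W * (1 + c * b) = D * ((m x)\<^sup>2 + 2 * sgn x * m x * b) + \<eta>"
        using W by (simp add: c_def distrib_left) (simp add: W_def algebra_simps)
      also have "\<dots> \<le> D * (m (x + b))\<^sup>2 + \<eta>"
        using D sq_dist_interval_ge_tangent[of x R b] by (simp add: m_def)
      \<comment> \<open>The right side is nonnegative, so the affine lower bound may be cut off at
        0; this makes the power well behaved where the tangent is negative.\<close>
      finally have "W * max 0 (1 + c * b) \<le> D * (m (x + b))\<^sup>2 + \<eta>"
        using D \<eta> by (simp add: max_def)
      moreover have "W * e = \<kappa> * r" using W by (simp add: e_def)
      ultimately have *: "W * (max 0 (1 + c * b) + e) \<le> D * (m (x + b))\<^sup>2 + (\<eta> + \<kappa> * r)"
        by (simp add: distrib_left)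
      have "barrier p D R (\<eta> + \<kappa> * r) (x + b) \<le> (W * (max 0 (1 + c * b) + e)) powr (- p)"
        unfolding barrier_def m_def[symmetric] using * W e p
        by (intro powr_mono2') (auto simp: m_def intro!: mult_pos_pos add_nonneg_pos)
      also have "\<dots> = W powr (- p) * (max 0 (1 + c * b) + e) powr (- p)"
        using W e by (simp add: powr_mult)
      finally show ?thesis by (simp add: barrier_def W_def m_def)
    qed
    have "(\<integral>\<^sup>+b. ennreal (normal_density 0 (sqrt r) b) * ennreal (barrier p D R (\<eta> + \<kappa> * r) (x + b)) \<partial>lborel)
      \<le> (\<integral>\<^sup>+b. ennreal (barrier p D R \<eta> x) * (ennreal (normal_density 0 (sqrt r) b) *
           ennreal ((max 0 (1 + c * b) + e) powr (- p))) \<partial>lborel)"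
    proof (rule nn_integral_mono)
      fix b
      show "ennreal (normal_density 0 (sqrt r) b) * ennreal (barrier p D R (\<eta> + \<kappa> * r) (x + b))
        \<le> ennreal (barrier p D R \<eta> x) * (ennreal (normal_density 0 (sqrt r) b) *
           ennreal ((max 0 (1 + c * b) + e) powr (- p)))"
        using mult_left_mono[OF le[of b], of "normal_density 0 (sqrt r) b"]
        by (simp add: ennreal_mult[symmetric] ennreal_leI mult_ac)
    qed
    also have "\<dots> = ennreal (barrier p D R \<eta> x) * (\<integral>\<^sup>+b. ennreal (normal_density 0 (sqrt r) b) *
           ennreal ((max 0 (1 + c * b) + e) powr (- p)) \<partial>lborel)"
      by (rule nn_integral_cmult) measurable
    also have "\<dots> \<le> ennreal (barrier p D R \<eta> x) * 1"
      by (intro mult_left_mono gauss r e c) simp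
    finally show "(\<integral>\<^sup>+b. ennreal (normal_density 0 (sqrt r) b) * ennreal (barrier p D R (\<eta> + \<kappa> * r) (x + b)) \<partial>lborel)
      \<le> ennreal (barrier p D R \<eta> x)" by simp
  qed
qed

section \<open>The integral of the barrier over the line\<close>

lemma nn_integral_inverse_square:
  fixes R d :: real
  assumes d: "0 < d"
  shows "(\<integral>\<^sup>+x. ennreal (1 / (x - R)\<^sup>2) * indicator {R + d..} x \<partial>lborel) = ennreal (1 / d)"
proof -
  have "(\<integral>\<^sup>+x. ennreal (1 / (x - R)\<^sup>2) * indicator {R + d..} x \<partial>lborel) = ennreal (0 - (- 1 / (R + d - R)))"
  proof (rule nn_integral_FTC_atLeast)
    show "((\<lambda>x. - 1 / (x - R)) \<longlongrightarrow> 0) at_top" by real_asymp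
    show "DERIV (\<lambda>x. - 1 / (x - R)) x :> 1 / (x - R)\<^sup>2" if "R + d \<le> x" for x
      using that d by (auto intro!: derivative_eq_intros simp: power2_eq_square)
  qed auto
  then show ?thesis by simp
qed

text \<open>The line is cut at distance \<open>sqrt s\<close> from the interval. Inside, the barrier
  is at most \<open>(\<kappa> * s) powr (- p)\<close>. Outside, at distance \<open>d\<close>,
  \<open>p \<ge> 1\<close> lets the excess power \<open>(d\<^sup>2) powr (1 - p)\<close> be bounded
  by its value at the cut, leaving an integrable inverse square whose tail is
  \<open>1 / sqrt s\<close>. With this cut both parts are bounded by multiples of
  \<open>(R + sqrt s) * s powr (- p)\<close>.\<close>

lemma nn_integral_barrier_le:
  fixes p D \<kappa> R s \<eta> :: real
  assumes p: "1 \<le> p" and D: "0 < D" and \<kappa>: "0 < \<kappa>" and R: "0 \<le> R" and s: "0 < s" and \<eta>: "0 \<le> \<eta>"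
  shows "(\<integral>\<^sup>+x. ennreal (barrier p D R (\<eta> + \<kappa> * s) x) \<partial>lborel)
    \<le> ennreal (2 * (\<kappa> powr (- p) + D powr (- p)) * (R + sqrt s) * s powr (- p))"
proof -
  define a where "a = R + sqrt s"
  define A where "A = (\<kappa> * s) powr (- p)"
  define B where "B = D powr (- p) * s powr (1 - p)"
  define h where "h = (\<lambda>x. ennreal (1 / (x - R)\<^sup>2) * indicator {R + sqrt s..} x)"
  have AB: "0 \<le> A" "0 \<le> B" by (auto simp: A_def B_def)
  have h_meas [measurable]: "h \<in> borel_measurable borel" unfolding h_def by measurable
  have A: "barrier p D R (\<eta> + \<kappa> * s) x \<le> A" for x
    unfolding A_def barrier_def using p D \<kappa> s \<eta> by (intro powr_mono2') auto
  have B: "barrier p D R (\<eta> + \<kappa> * s) x \<le> B * (1 / (y - R)\<^sup>2)" if x: "a \<le> y" "y = \<bar>x\<bar>" for x y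
  proof -
    define d where "d = y - R"
    have sd: "sqrt s \<le> d" using x by (simp add: a_def d_def)
    have d: "0 < d" using sd s by (auto intro: less_le_trans[of _ "sqrt s"])
    have "barrier p D R (\<eta> + \<kappa> * s) x \<le> (D * d\<^sup>2) powr (- p)"
      unfolding barrier_def using p D \<kappa> s \<eta> d x(2) by (intro powr_mono2') (auto simp: d_def)
    also have "\<dots> = D powr (- p) * ((d\<^sup>2) powr (1 - p) * (1 / d\<^sup>2))"
      using D d by (simp add: powr_mult powr_minus_divide powr_diff)
    also have "(d\<^sup>2) powr (1 - p) \<le> s powr (1 - p)"
      using sd s p d by (intro powr_mono2') (auto dest: power_mono[of _ _ 2])
    finally show ?thesis using D by (simp add: B_def d_def mult_left_mono mult_right_mono divide_right_mono)
  qed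
  have le: "ennreal (barrier p D R (\<eta> + \<kappa> * s) x)
      \<le> ennreal A * indicator {-a..a} x + (ennreal B * h x + ennreal B * h (- x))" for x
  proof -
    consider "x \<in> {-a..a}" | "a \<le> x" | "a \<le> - x" by fastforce
    then show ?thesis
    proof cases
      case 1 then show ?thesis using ennreal_leI[OF A[of x]] by (simp add: add_increasing2)
    next
      case 2
      have "0 \<le> a" using R s by (simp add: a_def)
      then have "ennreal (barrier p D R (\<eta> + \<kappa> * s) x) \<le> ennreal (B * (1 / (x - R)\<^sup>2))"
        using 2 by (intro ennreal_leI B) auto
      also have "\<dots> = ennreal B * h x" using 2 AB by (simp add: h_def a_def ennreal_mult[symmetric])
      finally show ?thesis by (rule order_trans) (simp add: add_increasing add_increasing2)
    next
      case 3
      have "0 \<le> a" using R s by (simp add: a_def)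
      then have "ennreal (barrier p D R (\<eta> + \<kappa> * s) x) \<le> ennreal (B * (1 / (- x - R)\<^sup>2))"
        using 3 by (intro ennreal_leI B) auto
      also have "\<dots> = ennreal B * h (- x)" using 3 AB by (simp add: h_def a_def ennreal_mult[symmetric])
      finally show ?thesis by (rule order_trans) (simp add: add_increasing)
    qed
  qed
  have a0: "0 \<le> a" using R s by (simp add: a_def)
  have h1: "(\<integral>\<^sup>+x. h x \<partial>lborel) = ennreal (1 / sqrt s)"
    unfolding h_def using s by (intro nn_integral_inverse_square) simp
  have h2: "(\<integral>\<^sup>+x. h (- x) \<partial>lborel) = ennreal (1 / sqrt s)"
    using nn_integral_real_affine[of h "-1" 0] h1 by simp
  have "(\<integral>\<^sup>+x. ennreal (barrier p D R (\<eta> + \<kappa> * s) x) \<partial>lborel)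
    \<le> (\<integral>\<^sup>+x. ennreal A * indicator {-a..a} x + (ennreal B * h x + ennreal B * h (- x)) \<partial>lborel)"
    by (intro nn_integral_mono le)
  also have "\<dots> = ennreal A * ennreal (2 * a) + (ennreal B * ennreal (1 / sqrt s) + ennreal B * ennreal (1 / sqrt s))"
    using a0 by (simp add: nn_integral_add nn_integral_cmult h1 h2)
  also have "\<dots> = ennreal (A * (2 * a) + (B * (1 / sqrt s) + B * (1 / sqrt s)))"
    using AB a0 s by (simp add: ennreal_mult[symmetric] ennreal_plus[symmetric] del: ennreal_plus)
  also have "\<dots> \<le> ennreal (2 * (\<kappa> powr (- p) + D powr (- p)) * (R + sqrt s) * s powr (- p))"
  proof (rule ennreal_leI)
    have "B * (1 / sqrt s) = D powr (- p) * s powr (- p) * (s / sqrt s)"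
      using s by (simp add: B_def powr_diff powr_minus_divide)
    also have "s / sqrt s = sqrt s" using s by (simp add: real_div_sqrt)
    also have "D powr (- p) * s powr (- p) * sqrt s \<le> D powr (- p) * s powr (- p) * (R + sqrt s)"
      using R by (intro mult_left_mono) auto
    finally have "B * (1 / sqrt s) \<le> D powr (- p) * s powr (- p) * (R + sqrt s)" .
    moreover have "A * a = \<kappa> powr (- p) * s powr (- p) * (R + sqrt s)"
      using s \<kappa> by (simp add: A_def a_def powr_mult)
    ultimately have "2 * (A * a) + 2 * (B * (1 / sqrt s)) \<le> 2 * (\<kappa> powr (- p) * s powr (- p) * (R + sqrt s))
        + 2 * (D powr (- p) * s powr (- p) * (R + sqrt s))" by linarith
    then show "A * (2 * a) + (B * (1 / sqrt s) + B * (1 / sqrt s))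
      \<le> 2 * (\<kappa> powr (- p) + D powr (- p)) * (R + sqrt s) * s powr (- p)"
      by (simp add: distrib_left distrib_right mult_ac)
  qed
  finally show ?thesis .
qed

section \<open>One-point law and measurability of the flow\<close>

lemma arratia_flow_prob_space: "arratia_flow N \<phi> \<Longrightarrow> prob_space N"
  by (simp add: arratia_flow_def)

lemma arratia_flow_measurable: "arratia_flow N \<phi> \<Longrightarrow> (\<lambda>\<omega>. \<phi> \<omega> a t) \<in> borel_measurable N"
  by (simp add: arratia_flow_def)

text \<open>A single path has nothing to coalesce with: \<open>merge_path [] b\<close> finds no
  meeting time and returns \<open>b\<close>. The finite-dimensional law for one starting point and
  one time is thus that of \<open>a\<close> plus a Gaussian increment.\<close>

lemma arratia_flow_one_point:
  assumes flow: "arratia_flow N \<phi>" and t: "0 < t" and F [measurable]: "F \<in> borel_measurable borel"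
  shows "(\<integral>\<^sup>+\<omega>. F (\<phi> \<omega> a t) \<partial>N) = (\<integral>\<^sup>+b. ennreal (normal_density 0 (sqrt t) b) * F (a + b) \<partial>lborel)"
proof -
  let ?I = "{..<length [a]} \<times> {..<length [t]}"
  note [measurable] = arratia_flow_measurable[OF flow]
  have "\<forall>(as::real list) (ts::real list). (\<forall>t\<in>set ts. 0 \<le> t) \<longrightarrow>
        (\<exists>(P :: (nat \<Rightarrow> real \<Rightarrow> real) measure) B. indep_BMs P B as \<and>
           distr N (Pi\<^sub>M ({..<length as} \<times> {..<length ts}) (\<lambda>_. borel))
             (\<lambda>\<omega>. \<lambda>x\<in>{..<length as} \<times> {..<length ts}. \<phi> \<omega> (as ! fst x) (ts ! snd x))
         = distr P (Pi\<^sub>M ({..<length as} \<times> {..<length ts}) (\<lambda>_. borel))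
             (\<lambda>\<omega>. \<lambda>x\<in>{..<length as} \<times> {..<length ts}.
                (coal_paths (map (\<lambda>i. B i \<omega>) [0..<length as]) ! fst x) (ts ! snd x)))"
    using flow unfolding arratia_flow_def by blast
  from this[rule_format, of "[t]" "[a]"] t
  obtain P :: "(nat \<Rightarrow> real \<Rightarrow> real) measure" and B where BM: "indep_BMs P B [a]" and
    eq: "distr N (Pi\<^sub>M ?I (\<lambda>_. borel)) (\<lambda>\<omega>. \<lambda>x\<in>?I. \<phi> \<omega> ([a] ! fst x) ([t] ! snd x))
      = distr P (Pi\<^sub>M ?I (\<lambda>_. borel))
          (\<lambda>\<omega>. \<lambda>x\<in>?I. (coal_paths (map (\<lambda>i. B i \<omega>) [0..<length [a]]) ! fst x) ([t] ! snd x))"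
    by auto
  have B0: "\<And>\<omega>. \<omega> \<in> space P \<Longrightarrow> B 0 \<omega> 0 = a"
    and Bm [measurable]: "\<And>t. (\<lambda>\<omega>. B 0 \<omega> t) \<in> borel_measurable P"
    and law: "distributed P lborel (\<lambda>\<omega>. B 0 \<omega> t - B 0 \<omega> 0) (normal_density 0 (sqrt t))"
  proof -
    show "\<And>\<omega>. \<omega> \<in> space P \<Longrightarrow> B 0 \<omega> 0 = a" "\<And>t. (\<lambda>\<omega>. B 0 \<omega> t) \<in> borel_measurable P"
      using BM by (auto simp: indep_BMs_def)
    have "\<forall>ts::real list. sorted_wrt (<) ts \<and> ts \<noteq> [] \<and> hd ts = 0 \<longrightarrow>
        (\<forall>i<length [a]. \<forall>j<length ts - 1.
           distributed P lborel (\<lambda>\<omega>. B i \<omega> (ts ! Suc j) - B i \<omega> (ts ! j))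
             (normal_density 0 (sqrt (ts ! Suc j - ts ! j))))"
      using BM unfolding indep_BMs_def by blast
    from this[rule_format, of "[0, t]" 0 0] t
    show "distributed P lborel (\<lambda>\<omega>. B 0 \<omega> t - B 0 \<omega> 0) (normal_density 0 (sqrt t))" by simp
  qed
  have coal: "coal_paths (map (\<lambda>i. B i \<omega>) [0..<length [a]]) ! 0 = B 0 \<omega>" for \<omega>
    by (simp add: coal_paths_def merge_path_def)
  have I: "?I = {(0, 0)}" by auto
  let ?X = "\<lambda>\<omega>. \<lambda>x\<in>?I. \<phi> \<omega> ([a] ! fst x) ([t] ! snd x)"
  let ?Y = "\<lambda>\<omega>. \<lambda>x\<in>?I. (coal_paths (map (\<lambda>i. B i \<omega>) [0..<length [a]]) ! fst x) ([t] ! snd x)"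
  have X: "?X \<in> measurable N (Pi\<^sub>M ?I (\<lambda>_. borel))"
    by (rule measurable_restrict) (auto simp: arratia_flow_measurable[OF flow])
  have Y: "?Y \<in> measurable P (Pi\<^sub>M ?I (\<lambda>_. borel))"
  proof (rule measurable_restrict)
    fix i assume "i \<in> ?I"
    then have i: "i = (0, 0)" unfolding I by simp
    show "(\<lambda>\<omega>. (coal_paths (map (\<lambda>i. B i \<omega>) [0..<length [a]]) ! fst i) ([t] ! snd i)) \<in> borel_measurable P"
      unfolding i fst_conv snd_conv coal using Bm[of t] by simp
  qed
  have G: "(\<lambda>x. F (x (0, 0))) \<in> borel_measurable (Pi\<^sub>M ?I (\<lambda>_. borel :: real measure))"
    unfolding I by measurable
  have "(\<integral>\<^sup>+\<omega>. F (\<phi> \<omega> a t) \<partial>N) = (\<integral>\<^sup>+\<omega>. F (?X \<omega> (0, 0)) \<partial>N)" by simp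
  also have "\<dots> = (\<integral>\<^sup>+x. F (x (0, 0)) \<partial>distr N (Pi\<^sub>M ?I (\<lambda>_. borel)) ?X)"
    by (rule nn_integral_distr[OF X, symmetric]) (use G in simp)
  also have "\<dots> = (\<integral>\<^sup>+\<omega>. F (?Y \<omega> (0, 0)) \<partial>P)"
    unfolding eq by (rule nn_integral_distr[OF Y]) (use G in simp)
  also have "\<dots> = (\<integral>\<^sup>+\<omega>. F (B 0 \<omega> t) \<partial>P)"
    by (rule nn_integral_cong) (simp add: coal_paths_def merge_path_def)
  also have "\<dots> = (\<integral>\<^sup>+\<omega>. F (a + (B 0 \<omega> t - B 0 \<omega> 0)) \<partial>P)"
    by (rule nn_integral_cong) (simp add: B0)
  also have "\<dots> = (\<integral>\<^sup>+b. ennreal (normal_density 0 (sqrt t) b) * F (a + b) \<partial>lborel)"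
    by (rule distributed_nn_integral[OF law, symmetric]) measurable
  finally show ?thesis .
qed

text \<open>Right continuity in \<open>a\<close> makes the flow a pointwise limit of maps that use
  only countably many starting points, each measurable in the random parameter.\<close>

lemma arratia_flow_jointly_measurable:
  assumes flow: "arratia_flow N \<phi>" and t: "0 \<le> t"
  shows "(\<lambda>(\<omega>, a). \<phi> \<omega> a t) \<in> borel_measurable (N \<Otimes>\<^sub>M borel)"
proof -
  \<comment> \<open>The \<open>+ 1\<close> places the grid point strictly to the right of
    \<open>a\<close>, so that the approximation converges along \<open>at_right\<close> even when
    \<open>a\<close> lies on the grid.\<close>
  let ?r = "\<lambda>n a. real_of_int (\<lfloor>real (Suc n) * a\<rfloor> + 1) / real (Suc n)"
  note [measurable] = arratia_flow_measurable[OF flow]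
  have "(\<lambda>x. \<phi> (fst x) (snd x) t) \<in> borel_measurable (N \<Otimes>\<^sub>M borel)"
  proof (rule borel_measurable_LIMSEQ_real)
    fix x assume "x \<in> space (N \<Otimes>\<^sub>M (borel :: real measure))"
    then have \<omega>: "fst x \<in> space N" by (auto simp: space_pair_measure)
    have lower: "snd x < ?r n (snd x)" for n
      by (simp add: less_divide_eq mult.commute)
    have upper: "?r n (snd x) \<le> snd x + 1 / real (Suc n)" for n
    proof -
      have "real_of_int (\<lfloor>real (Suc n) * snd x\<rfloor> + 1) \<le> real (Suc n) * snd x + 1" by linarith
      then have "?r n (snd x) \<le> (real (Suc n) * snd x + 1) / real (Suc n)" by (rule divide_right_mono) simp
      also have "\<dots> = snd x + 1 / real (Suc n)" by (simp add: field_simps)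
      finally show ?thesis .
    qed
    have "(\<lambda>n. ?r n (snd x)) \<longlonglongrightarrow> snd x"
    proof (rule tendsto_sandwich[where f = "\<lambda>n. snd x" and h = "\<lambda>n. snd x + 1 / real (Suc n)"])
      show "(\<lambda>n. snd x + 1 / real (Suc n)) \<longlonglongrightarrow> snd x"
        using tendsto_add[OF tendsto_const LIMSEQ_inverse_real_of_nat, of "snd x"]
        by (simp add: inverse_eq_divide)
      show "(\<lambda>n. snd x) \<longlonglongrightarrow> snd x" by simp
      show "\<forall>\<^sub>F n in sequentially. snd x \<le> ?r n (snd x)"
        using lower by (intro always_eventually allI less_imp_le)
      show "\<forall>\<^sub>F n in sequentially. ?r n (snd x) \<le> snd x + 1 / real (Suc n)"
        using upper by (intro always_eventually allI)
    qed
    then have "filterlim (\<lambda>n. ?r n (snd x)) (at_right (snd x)) sequentially"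
      using lower by (intro tendsto_imp_filterlim_at_right always_eventually allI)
    moreover have "((\<lambda>a. \<phi> (fst x) a t) \<longlongrightarrow> \<phi> (fst x) (snd x) t) (at_right (snd x))"
      using flow \<omega> t by (simp add: arratia_flow_def continuous_within)
    ultimately show "(\<lambda>n. \<phi> (fst x) (?r n (snd x)) t) \<longlonglongrightarrow> \<phi> (fst x) (snd x) t"
      by (rule filterlim_compose[rotated])
  next
    fix n
    have "(\<lambda>x. (\<lambda>i x. \<phi> (fst x) (real_of_int (i + 1) / real (Suc n)) t) (\<lfloor>real (Suc n) * snd x\<rfloor>) x)
        \<in> borel_measurable (N \<Otimes>\<^sub>M (borel :: real measure))"
      by (rule measurable_compose_countable) measurable
    then show "(\<lambda>x. \<phi> (fst x) (?r n (snd x)) t) \<in> borel_measurable (N \<Otimes>\<^sub>M (borel :: real measure))"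
      by simp
  qed
  then show ?thesis by (simp add: case_prod_beta')
qed

section \<open>Radon measures and Jensen's inequality for Laplace functionals\<close>

definition radon :: "real measure \<Rightarrow> bool" where
  "radon \<mu> \<longleftrightarrow> sets \<mu> = sets borel \<and> (\<forall>K. compact K \<longrightarrow> emeasure \<mu> K < \<infinity>)"

lemma radon_sigma_finite:
  assumes "radon \<mu>"
  shows "sigma_finite_measure \<mu>"
proof
  have sets: "sets \<mu> = sets borel" and fin: "emeasure \<mu> K < \<infinity>" if "compact K" for K
    using assms that by (auto simp: radon_def)
  then have sp: "space \<mu> = UNIV" and [simp]: "sets \<mu> = sets borel"
    using sets_eq_imp_space_eq[of \<mu> borel] assms by (auto simp: radon_def)
  have "x \<in> (\<Union>n::nat. {- real n..real n})" for x
  proof -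
    obtain n :: nat where "\<bar>x\<bar> \<le> real n" using real_arch_simple by blast
    then have "x \<in> {- real n..real n}" by auto
    then show ?thesis by blast
  qed
  then have "\<Union> (range (\<lambda>n::nat. {- real n..real n})) = space \<mu>" using sp by blast
  then show "\<exists>A. countable A \<and> A \<subseteq> sets \<mu> \<and> \<Union> A = space \<mu> \<and> (\<forall>a\<in>A. emeasure \<mu> a \<noteq> \<infinity>)"
    using fin by (intro exI[of _ "range (\<lambda>n::nat. {- real n..real n})"]) (auto simp: less_top)
qed

text \<open>The continuous extension of \<open>exp (- x)\<close> to infinity. The integral of the
  barrier can diverge, and a Bochner integral would then be 0 and give the exponential 1 instead of
  the correct limit 0.\<close>

definition lap :: "ennreal \<Rightarrow> real" where
  "lap x = (if x = \<infinity> then 0 else exp (- enn2real x))"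

lemma lap_ennreal: "0 \<le> c \<Longrightarrow> lap (ennreal c) = exp (- c)"
  by (simp add: lap_def)

lemma lap_top [simp]: "lap \<top> = 0"
  by (simp add: lap_def)

lemma lap_nonneg [simp]: "0 \<le> lap x" and lap_le_one [simp]: "lap x \<le> 1"
  by (auto simp: lap_def)

lemma lap_antimono: "x \<le> y \<Longrightarrow> lap y \<le> lap x"
  by (cases x; cases y) (auto simp: lap_ennreal lap_def ennreal_le_iff top_unique)

lemma lap_measurable [measurable]: "lap \<in> borel_measurable borel"
  unfolding lap_def[abs_def] by measurable

lemma one_minus_lap_le: "ennreal (1 - lap x) \<le> x"
proof (cases x)
  case (real r)
  then show ?thesis using exp_ge_add_one_self[of "- r"] by (simp add: lap_ennreal ennreal_le_iff)
qed simp

lemma tendsto_lap: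
  assumes f: "(f \<longlongrightarrow> x) F"
  shows "((\<lambda>i. lap (f i)) \<longlongrightarrow> lap x) F"
proof (cases "x = \<top>")
  case False
  have ev: "\<forall>\<^sub>F i in F. f i < \<top>" using f False by (intro order_tendstoD) (auto simp: less_top)
  have "((\<lambda>i. enn2real (f i)) \<longlongrightarrow> enn2real x) F"
    using f False by (intro tendsto_enn2real) (auto simp: less_top)
  then have "((\<lambda>i. exp (- enn2real (f i))) \<longlongrightarrow> exp (- enn2real x)) F"
    by (intro tendsto_exp tendsto_minus)
  then show ?thesis
    using False by (subst tendsto_cong[of _ "\<lambda>i. exp (- enn2real (f i))"])
      (auto simp: lap_def intro: eventually_mono[OF ev])
next
  case True
  show ?thesis
  proof (rule order_tendstoI)
    fix a assume "a < lap x"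
    then show "\<forall>\<^sub>F i in F. a < lap (f i)" using True by (intro always_eventually) (auto intro: less_le_trans)
  next
    fix a assume "lap x < a"
    then have a: "0 < a" using True by simp
    define c where "c = max 0 (1 - ln a)"
    have "exp (- c) \<le> exp (ln a - 1)" by (simp add: c_def)
    also have "\<dots> < exp (ln a)" by simp
    finally have c: "exp (- c) < a" using a by simp
    have "\<forall>\<^sub>F i in F. ennreal c < f i" using f True by (intro order_tendstoD) auto
    then show "\<forall>\<^sub>F i in F. lap (f i) < a"
    proof eventually_elim
      case (elim i)
      then have "lap (f i) \<le> lap (ennreal c)" by (intro lap_antimono) simp
      also have "\<dots> = exp (- c)" by (intro lap_ennreal) (simp add: c_def)
      finally show ?case using c by simp
    qed
  qed
qed

text \<open>Tonelli followed by Jensen, the latter through the tangent of \<open>exp (- x)\<close>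
  at the mean bound \<open>c\<close>. The left side involves the flow only through its one-point
  laws. If the double integral diverges, the left side is 0.\<close>

lemma lap_double_integral_le:
  assumes flow: "arratia_flow N \<phi>" and t: "0 \<le> t" and \<mu>: "radon \<mu>"
    and h [measurable]: "h \<in> borel_measurable borel" and h0: "\<And>x. 0 \<le> h x"
  shows "lap (\<integral>\<^sup>+a. (\<integral>\<^sup>+\<omega>. ennreal (h (\<phi> \<omega> a t)) \<partial>N) \<partial>\<mu>) \<le> (\<integral>\<omega>. exp (- (\<integral>a. h (\<phi> \<omega> a t) \<partial>\<mu>)) \<partial>N)"
proof -
  interpret N: prob_space N using flow by (rule arratia_flow_prob_space)
  interpret mu: sigma_finite_measure \<mu> using \<mu> by (rule radon_sigma_finite)
  interpret pair_sigma_finite N \<mu> ..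
  have [measurable_cong, simp]: "sets \<mu> = sets borel" using \<mu> by (simp add: radon_def)
  note [measurable] = arratia_flow_jointly_measurable[OF flow t]
  define m where "m = (\<integral>\<^sup>+a. (\<integral>\<^sup>+\<omega>. ennreal (h (\<phi> \<omega> a t)) \<partial>N) \<partial>\<mu>)"
  define X where "X = (\<lambda>\<omega>. \<integral>a. h (\<phi> \<omega> a t) \<partial>\<mu>)"
  have X0: "0 \<le> X \<omega>" for \<omega> by (simp add: X_def h0)
  have X_meas [measurable]: "X \<in> borel_measurable N"
    unfolding X_def by measurable
  have exp_int: "integrable N (\<lambda>\<omega>. exp (- X \<omega>))"
    by (rule N.integrable_const_bound[of _ 1]) (auto simp: X0)
  show ?thesis
  proof (cases m)
    case top
    then show ?thesis by (simp add: m_def[symmetric])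
  next
    case (real c)
    \<comment> \<open>Only an inequality: where the inner integral diverges, \<open>X\<close> takes
      the default value 0. That only increases \<open>exp (- X \<omega>)\<close>, so the error goes
      in the right direction.\<close>
    have "(\<integral>\<^sup>+\<omega>. ennreal (X \<omega>) \<partial>N) \<le> (\<integral>\<^sup>+\<omega>. (\<integral>\<^sup>+a. ennreal (h (\<phi> \<omega> a t)) \<partial>\<mu>) \<partial>N)"
    proof (rule nn_integral_mono)
      fix \<omega> assume [measurable]: "\<omega> \<in> space N"
      have "X \<omega> = enn2real (\<integral>\<^sup>+a. ennreal (h (\<phi> \<omega> a t)) \<partial>\<mu>)"
        unfolding X_def by (rule integral_eq_nn_integral) (auto simp: h0)
      then show "ennreal (X \<omega>) \<le> (\<integral>\<^sup>+a. ennreal (h (\<phi> \<omega> a t)) \<partial>\<mu>)"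
        by (simp add: ennreal_enn2real_if)
    qed
    also have "\<dots> = m" unfolding m_def by (rule Fubini'[symmetric]) measurable
    finally have le: "(\<integral>\<^sup>+\<omega>. ennreal (X \<omega>) \<partial>N) \<le> ennreal c" using real by simp
    have X_int: "integrable N X"
      using le X0 by (intro integrableI_nonneg) (auto simp: less_top[symmetric] top_unique)
    have EX: "(\<integral>\<omega>. X \<omega> \<partial>N) \<le> c"
      using le real by (subst (asm) nn_integral_eq_integral[OF X_int]) (auto simp: X0 ennreal_le_iff)
    have "lap m = exp (- c) * 1" using real by (simp add: lap_ennreal)
    also have "\<dots> \<le> exp (- c) * (1 + c - (\<integral>\<omega>. X \<omega> \<partial>N))" using EX by (intro mult_left_mono) auto
    also have "\<dots> = (\<integral>\<omega>. exp (- c) * (1 + c - X \<omega>) \<partial>N)"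
      using X_int by (simp add: N.prob_space)
    also have "\<dots> \<le> (\<integral>\<omega>. exp (- X \<omega>) \<partial>N)"
    proof (rule integral_mono)
      show "integrable N (\<lambda>\<omega>. exp (- c) * (1 + c - X \<omega>))" using X_int by simp
      fix \<omega>
      have "exp (- c) * (1 + (c - X \<omega>)) \<le> exp (- c) * exp (c - X \<omega>)"
        by (intro mult_left_mono exp_ge_add_one_self) simp
      also have "\<dots> = exp (- X \<omega>)" by (simp add: exp_add[symmetric])
      finally show "exp (- c) * (1 + c - X \<omega>) \<le> exp (- X \<omega>)" by (simp add: algebra_simps)
    qed (rule exp_int)
    finally show ?thesis by (simp add: m_def X_def)
  qed
qed

section \<open>Measurability of kernel integrals and a maximal inequality\<close>

text \<open>The measures \<open>K \<omega>\<close> may have infinite mass, so measurability is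
  carried from sets to functions by monotone-class induction.\<close>

lemma nn_integral_kernel_measurable:
  assumes sets: "\<And>\<omega>. \<omega> \<in> space G \<Longrightarrow> sets (K \<omega>) = sets L"
    and K: "\<And>B. B \<in> sets L \<Longrightarrow> (\<lambda>\<omega>. emeasure (K \<omega>) B) \<in> borel_measurable G"
    and f: "f \<in> borel_measurable L"
  shows "(\<lambda>\<omega>. \<integral>\<^sup>+x. f x \<partial>K \<omega>) \<in> borel_measurable G"
proof -
  have meas: "u \<in> borel_measurable (K \<omega>)" if "u \<in> borel_measurable L" "\<omega> \<in> space G"
    for u :: "'b \<Rightarrow> ennreal" and \<omega>
    using that(1) measurable_cong_sets[OF sets[OF that(2)] refl] by blast
  show ?thesis using f
  proof (induction rule: borel_measurable_induct)
    case (cong f g)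
    have "(\<integral>\<^sup>+x. f x \<partial>K \<omega>) = (\<integral>\<^sup>+x. g x \<partial>K \<omega>)" if "\<omega> \<in> space G" for \<omega>
      using cong sets_eq_imp_space_eq[OF sets[OF that]] by (intro nn_integral_cong) auto
    then show ?case using cong.IH by (subst measurable_cong) auto
  next
    case (set A)
    then show ?case using K[OF set] sets by (subst measurable_cong[of _ _ "\<lambda>\<omega>. emeasure (K \<omega>) A"]) auto
  next
    case (mult u c)
    have "(\<integral>\<^sup>+x. c * u x \<partial>K \<omega>) = c * (\<integral>\<^sup>+x. u x \<partial>K \<omega>)" if "\<omega> \<in> space G" for \<omega>
      by (intro nn_integral_cmult meas that mult.hyps)
    then show ?case using mult.IH by (subst measurable_cong[of _ _ "\<lambda>\<omega>. c * (\<integral>\<^sup>+x. u x \<partial>K \<omega>)"]) auto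
  next
    case (add u v)
    have "(\<integral>\<^sup>+x. v x + u x \<partial>K \<omega>) = (\<integral>\<^sup>+x. v x \<partial>K \<omega>) + (\<integral>\<^sup>+x. u x \<partial>K \<omega>)" if "\<omega> \<in> space G" for \<omega>
      by (intro nn_integral_add meas that add.hyps)
    then show ?case using add.IH
      by (subst measurable_cong[of _ _ "\<lambda>\<omega>. (\<integral>\<^sup>+x. v x \<partial>K \<omega>) + (\<integral>\<^sup>+x. u x \<partial>K \<omega>)"]) auto
  next
    case (seq U)
    have eq: "(SUP i. U i) = (\<lambda>x. SUP i. U i x)" by (rule ext) (simp add: image_comp)
    have "(\<integral>\<^sup>+x. (SUP i. U i x) \<partial>K \<omega>) = (SUP i. \<integral>\<^sup>+x. U i x \<partial>K \<omega>)" if "\<omega> \<in> space G" for \<omega>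
      by (intro nn_integral_monotone_convergence_SUP meas that seq.hyps)
    then show ?case unfolding eq using seq.IH
      by (subst measurable_cong[of _ _ "\<lambda>\<omega>. SUP i. \<integral>\<^sup>+x. U i x \<partial>K \<omega>"]) auto
  qed
qed

text \<open>This is the maximal inequality for nonnegative supermartingales, without stopping times.
  The quantity in \<open>step\<close>, namely \<open>l\<close> times the probability of having
  reached level \<open>l\<close> before \<open>n\<close> plus the expectation of \<open>X n\<close>
  on the complement, never exceeds the initial mean.\<close>

lemma maximal_inequality:
  fixes F :: "nat \<Rightarrow> 'a measure" and X :: "nat \<Rightarrow> 'a \<Rightarrow> real"
  assumes "prob_space M" and sp: "\<And>n. space (F n) = space M" and sub: "\<And>n. sets (F n) \<subseteq> sets M"
    and mono: "\<And>n. sets (F n) \<subseteq> sets (F (Suc n))"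
    and meas: "\<And>n. X n \<in> borel_measurable (F n)" and X: "\<And>n \<omega>. 0 \<le> X n \<omega>" "\<And>n \<omega>. X n \<omega> \<le> 1"
    and super: "\<And>n A. A \<in> sets (F n) \<Longrightarrow> (\<integral>\<omega>\<in>A. X (Suc n) \<omega> \<partial>M) \<le> (\<integral>\<omega>\<in>A. X n \<omega> \<partial>M)"
    and l: "0 < l"
  shows "l * measure M {\<omega>\<in>space M. \<exists>n. l \<le> X n \<omega>} \<le> (\<integral>\<omega>. X 0 \<omega> \<partial>M)"
proof -
  interpret prob_space M by fact
  have measM [measurable]: "X n \<in> borel_measurable M" for n
    using meas[of n] sp[of n] sub[of n] by (auto simp: measurable_def)
  have int: "integrable M (\<lambda>\<omega>. indicator A \<omega> * X n \<omega>)" if "A \<in> sets M" for A n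
    using that X by (intro integrable_const_bound[of _ 1]) (auto simp: indicator_def)
  define S where "S n = {\<omega>\<in>space M. \<forall>j<n. X j \<omega> < l}" for n
  have F_mono: "sets (F i) \<subseteq> sets (F j)" if "i \<le> j" for i j
    using that by (induction rule: dec_induct) (use mono in auto)
  have Xj: "X j \<in> borel_measurable (F n)" if "j \<le> n" for j n
    using meas[of j] F_mono[OF that] sp[of n] sp[of j] by (auto simp: measurable_def)
  \<comment> \<open>\<open>S (Suc n)\<close> concerns the indices up to \<open>n\<close> only, so it
    is known at time \<open>n\<close> and the supermartingale inequality from \<open>n\<close> to
    \<open>Suc n\<close> applies on it.\<close>
  have S: "S (Suc n) \<in> sets (F n)" for n
  proof -
    have "{\<omega>\<in>space (F n). \<forall>j\<in>{..n}. X j \<omega> < l} \<in> sets (F n)"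
      using Xj by (intro sets.sets_Collect_finite_All borel_measurable_less) auto
    moreover have "S (Suc n) = {\<omega>\<in>space (F n). \<forall>j\<in>{..n}. X j \<omega> < l}"
      unfolding S_def sp by (auto simp: less_Suc_eq_le)
    ultimately show ?thesis by (simp only:)
  qed
  have SM [measurable]: "S n \<in> sets M" for n
    unfolding S_def by measurable
  have step: "l * measure M (space M - S n) + (\<integral>\<omega>. indicator (S n) \<omega> * X n \<omega> \<partial>M) \<le> (\<integral>\<omega>. X 0 \<omega> \<partial>M)" for n
  proof (induction n)
    case 0
    have "S 0 = space M" by (simp add: S_def)
    then show ?case by (simp add: Bochner_Integration.integral_cong[of M M "\<lambda>\<omega>. indicator (space M) \<omega> * X 0 \<omega>" "X 0"])
  next
    case (Suc n)
    \<comment> \<open>\<open>?H\<close> is the event that level \<open>l\<close> is reached for the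
      first time at \<open>n\<close>; there \<open>X n\<close> pays for the newly counted
      probability.\<close>
    let ?H = "S n - S (Suc n)"
    have sub: "S (Suc n) \<subseteq> S n" by (auto simp: S_def)
    have "l * measure M ?H = (\<integral>\<omega>. l * indicator ?H \<omega> \<partial>M)" by simp
    also have "\<dots> \<le> (\<integral>\<omega>. indicator ?H \<omega> * X n \<omega> \<partial>M)"
      by (intro integral_mono int integrable_mult_right integrable_real_indicator)
        (auto simp: S_def indicator_def less_Suc_eq emeasure_eq_measure)
    finally have 1: "l * measure M ?H \<le> (\<integral>\<omega>. indicator ?H \<omega> * X n \<omega> \<partial>M)" .
    have "(\<integral>\<omega>. indicator (S (Suc n)) \<omega> * X (Suc n) \<omega> \<partial>M) \<le> (\<integral>\<omega>. indicator (S (Suc n)) \<omega> * X n \<omega> \<partial>M)"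
      using super[OF S[of n]] by (simp add: set_lebesgue_integral_def)
    moreover have "(\<integral>\<omega>. indicator (S n) \<omega> * X n \<omega> \<partial>M)
        = (\<integral>\<omega>. indicator (S (Suc n)) \<omega> * X n \<omega> \<partial>M) + (\<integral>\<omega>. indicator ?H \<omega> * X n \<omega> \<partial>M)"
    proof -
      have "(\<integral>\<omega>. indicator (S n) \<omega> * X n \<omega> \<partial>M)
          = (\<integral>\<omega>. indicator (S (Suc n)) \<omega> * X n \<omega> + indicator ?H \<omega> * X n \<omega> \<partial>M)"
        using sub by (intro Bochner_Integration.integral_cong) (auto simp: indicator_def)
      also have "\<dots> = (\<integral>\<omega>. indicator (S (Suc n)) \<omega> * X n \<omega> \<partial>M) + (\<integral>\<omega>. indicator ?H \<omega> * X n \<omega> \<partial>M)"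
        by (intro Bochner_Integration.integral_add int) auto
      finally show ?thesis .
    qed
    moreover have "measure M (space M - S (Suc n)) = measure M (space M - S n) + measure M ?H"
    proof -
      have "space M - S (Suc n) = (space M - S n) \<union> ?H" using sub by (auto simp: S_def)
      then show ?thesis by (simp add: finite_measure_Union[of "space M - S n" ?H] Diff_Int_distrib2)
    qed
    ultimately show ?case using 1 Suc by (simp add: distrib_left)
  qed
  let ?E = "{\<omega>\<in>space M. \<exists>n. l \<le> X n \<omega>}"
  have "(\<lambda>n. measure M (space M - S n)) \<longlonglongrightarrow> measure M (\<Union>n. space M - S n)"
    by (rule finite_Lim_measure_incseq) (auto simp: incseq_def S_def)
  moreover have "(\<Union>n. space M - S n) = ?E"
  proof (intro set_eqI iffI)
    fix \<omega> assume "\<omega> \<in> ?E"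
    then obtain n where "\<omega> \<in> space M" "l \<le> X n \<omega>" by auto
    then have "\<omega> \<in> space M - S (Suc n)" by (auto simp: S_def not_less)
    then show "\<omega> \<in> (\<Union>n. space M - S n)" by blast
  qed (auto simp: S_def not_less)
  ultimately have "(\<lambda>n. l * measure M (space M - S n)) \<longlonglongrightarrow> l * measure M ?E"
    by (intro tendsto_intros) simp
  then show ?thesis
  proof (rule LIMSEQ_le_const2, intro exI allI impI)
    fix n
    have "0 \<le> (\<integral>\<omega>. indicator (S n) \<omega> * X n \<omega> \<partial>M)" by (intro Bochner_Integration.integral_nonneg) (simp add: X)
    then show "l * measure M (space M - S n) \<le> (\<integral>\<omega>. X 0 \<omega> \<partial>M)" using step[of n] by linarith
  qed
qed

section \<open>The Markov property applied to the barrier\<close>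

lemma space_nat_filtration: "space (nat_filtration M Z s) = space M"
  by (simp add: nat_filtration_def space_measure_of_conv)

lemma sets_nat_filtration: "sets (nat_filtration M Z s) = sigma_sets (space M)
     {(\<lambda>\<omega>. emeasure (Z r \<omega>) B) -` U \<inter> space M | r B U.
        0 \<le> r \<and> r \<le> s \<and> B \<in> sets borel \<and> U \<in> sets (borel :: ennreal measure)}"
  unfolding nat_filtration_def by (rule sets_measure_of) auto

lemma nat_filtration_mono: "s \<le> t \<Longrightarrow> sets (nat_filtration M Z s) \<subseteq> sets (nat_filtration M Z t)"
  unfolding sets_nat_filtration by (rule sigma_sets_mono') force

context
  fixes \<beta> \<gamma> :: real and N :: "'b measure" and \<phi> :: "'b \<Rightarrow> real \<Rightarrow> real \<Rightarrow> real"
    and M :: "'a measure" and Z :: "real \<Rightarrow> 'a \<Rightarrow> real measure" and \<mu> :: "real measure"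
  assumes scbm: "scbm \<beta> \<gamma> N \<phi> M Z \<mu>"
begin

lemma scbm_prob_space: "prob_space M"
  using scbm by (simp add: scbm_def)

lemma scbm_radon: "0 \<le> t \<Longrightarrow> \<omega> \<in> space M \<Longrightarrow> radon (Z t \<omega>)"
  using scbm by (simp add: scbm_def radon_def)

lemma scbm_emeasure_measurable: "0 \<le> t \<Longrightarrow> B \<in> sets borel \<Longrightarrow> (\<lambda>\<omega>. emeasure (Z t \<omega>) B) \<in> borel_measurable M"
  using scbm by (simp add: scbm_def)

lemma nat_filtration_subset: "sets (nat_filtration M Z s) \<subseteq> sets M"
  unfolding sets_nat_filtration
  by (rule sets.sigma_sets_subset) (auto intro!: measurable_sets scbm_emeasure_measurable)

lemma nn_integral_scbm_measurable_filtration: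
  assumes "0 \<le> r" "r \<le> s" "f \<in> borel_measurable borel"
  shows "(\<lambda>\<omega>. \<integral>\<^sup>+x. f x \<partial>Z r \<omega>) \<in> borel_measurable (nat_filtration M Z s)"
proof (rule nn_integral_kernel_measurable[of _ _ borel])
  show "sets (Z r \<omega>) = sets borel" if "\<omega> \<in> space (nat_filtration M Z s)" for \<omega>
    using scbm_radon[OF assms(1)] that by (simp add: radon_def space_nat_filtration)
  fix B :: "real set" assume "B \<in> sets borel"
  then show "(\<lambda>\<omega>. emeasure (Z r \<omega>) B) \<in> borel_measurable (nat_filtration M Z s)"
    using assms by (intro measurableI) (auto simp: space_nat_filtration sets_nat_filtration intro!: sigma_sets.Basic)
qed (fact assms)

lemma nn_integral_scbm_measurable:
  assumes "0 \<le> r" "f \<in> borel_measurable borel"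
  shows "(\<lambda>\<omega>. \<integral>\<^sup>+x. f x \<partial>Z r \<omega>) \<in> borel_measurable M"
  using nn_integral_scbm_measurable_filtration[OF assms(1) order_refl assms(2)]
    nat_filtration_subset[of r] by (auto simp: measurable_def space_nat_filtration)

context
  assumes \<beta>: "0 < \<beta>" and \<gamma>: "0 < \<gamma>" and flow: "arratia_flow N \<phi>"
begin

text \<open>The Markov formula is applied to the truncations \<open>f n\<close> of the barrier, and
  dominated convergence removes the truncation. Jensen's lower bound is the same for every
  \<open>n\<close>, because \<open>psi\<close> of a truncation never exceeds the evolved barrier
  \<open>w\<close>: it equals \<open>w\<close> inside the window and 0 outside.\<close>

lemma scbm_lap_barrier_ge:
  fixes D R \<eta> s t :: real
  assumes D: "0 < D" and \<eta>: "0 < \<eta>" and s: "0 \<le> s" and t: "0 < t"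
    and A: "A \<in> sets (nat_filtration M Z s)"
  defines "v \<equiv> barrier (1 / \<beta>) D R \<eta>" and "w \<equiv> barrier (1 / \<beta>) D R (\<eta> + \<gamma> * \<beta> / (1 + \<beta>) * t)"
  shows "(\<integral>\<omega>\<in>A. lap (\<integral>\<^sup>+a. (\<integral>\<^sup>+b. ennreal (normal_density 0 (sqrt t) b) * ennreal (w (a + b)) \<partial>lborel) \<partial>Z s \<omega>) \<partial>M)
    \<le> (\<integral>\<omega>\<in>A. lap (\<integral>\<^sup>+x. ennreal (v x) \<partial>Z (s + t) \<omega>) \<partial>M)"
proof -
  interpret prob_space M by (rule scbm_prob_space)
  have AM [measurable]: "A \<in> sets M" using A nat_filtration_subset by blast
  have v_meas [measurable]: "v \<in> borel_measurable borel" and w_meas [measurable]: "w \<in> borel_measurable borel"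
    by (auto simp: v_def w_def)
  have v0: "0 \<le> v x" and w0: "0 \<le> w x" for x by (auto simp: v_def w_def)
  define f where "f n x = v x * indicator {- real n..real n} x" for n :: nat and x
  have f_meas [measurable]: "f n \<in> borel_measurable borel" for n
    unfolding f_def by measurable
  have f0: "0 \<le> f n x" for n x by (simp add: f_def v0)
  have v_le: "v x \<le> \<eta> powr (- (1 / \<beta>))" for x
    unfolding v_def using D \<eta> \<beta> by (intro barrier_le) auto
  have test: "test_fun (f n)" for n
    unfolding test_fun_def
  proof (intro conjI allI f_meas f0)
    show "bounded (range (f n))"
    proof -
      have "f n x \<le> \<eta> powr (- (1 / \<beta>))" for x
        using v_le[of x] by (simp add: f_def indicator_def)
      then show ?thesis unfolding bounded_iff using f0 by (intro exI[of _ "\<eta> powr (- (1 / \<beta>))"]) auto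
    qed
    have "{x. f n x \<noteq> 0} \<subseteq> {- real n..real n}" by (auto simp: f_def indicator_def)
    then show "bounded {x. f n x \<noteq> 0}" by (rule bounded_subset[rotated]) simp
  qed
  define Y where "Y \<omega> = lap (\<integral>\<^sup>+a. (\<integral>\<^sup>+b. ennreal (normal_density 0 (sqrt t) b) * ennreal (w (a + b)) \<partial>lborel) \<partial>Z s \<omega>)" for \<omega>
  have inner_meas: "(\<lambda>a. \<integral>\<^sup>+b. ennreal (normal_density 0 (sqrt t) b) * ennreal (w (a + b)) \<partial>lborel) \<in> borel_measurable borel"
    by measurable
  have Y_meas [measurable]: "Y \<in> borel_measurable M"
    unfolding Y_def by (intro measurable_compose[OF nn_integral_scbm_measurable lap_measurable] s inner_meas)
  have L_meas [measurable]: "(\<lambda>\<omega>. lap (\<integral>\<^sup>+x. ennreal (g x) \<partial>Z (s + t) \<omega>)) \<in> borel_measurable M"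
    if "g \<in> borel_measurable borel" for g
    using s t that by (intro measurable_compose[OF nn_integral_scbm_measurable lap_measurable]) auto
  have laplace_ge: "Y \<omega> \<le> scbm_laplace \<beta> \<gamma> N \<phi> t (f n) (Z s \<omega>)" if \<omega>: "\<omega> \<in> space M" for \<omega> n
  proof -
    have psi_meas [measurable]: "(\<lambda>x. psi \<beta> \<gamma> t (f n x)) \<in> borel_measurable borel"
      unfolding psi_def by measurable
    have psi_le: "0 \<le> psi \<beta> \<gamma> t (f n x)" "psi \<beta> \<gamma> t (f n x) \<le> w x" for x
    proof -
      show "0 \<le> psi \<beta> \<gamma> t (f n x)" by (simp add: psi_def f0)
      show "psi \<beta> \<gamma> t (f n x) \<le> w x"
        using psi_barrier[OF \<beta> \<gamma> D \<eta>, of t R x] t w0[of x]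
        by (cases "x \<in> {- real n..real n}") (auto simp: f_def v_def w_def psi_def)
    qed
    have "Y \<omega> \<le> lap (\<integral>\<^sup>+a. (\<integral>\<^sup>+\<omega>'. ennreal (psi \<beta> \<gamma> t (f n (\<phi> \<omega>' a t))) \<partial>N) \<partial>Z s \<omega>)"
      unfolding Y_def
    proof (intro lap_antimono nn_integral_mono)
      fix a
      have "(\<integral>\<^sup>+\<omega>'. ennreal (psi \<beta> \<gamma> t (f n (\<phi> \<omega>' a t))) \<partial>N)
          = (\<integral>\<^sup>+b. ennreal (normal_density 0 (sqrt t) b) * ennreal (psi \<beta> \<gamma> t (f n (a + b))) \<partial>lborel)"
        by (rule arratia_flow_one_point[OF flow t]) measurable
      also have "\<dots> \<le> (\<integral>\<^sup>+b. ennreal (normal_density 0 (sqrt t) b) * ennreal (w (a + b)) \<partial>lborel)"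
        by (intro nn_integral_mono mult_left_mono ennreal_leI psi_le) simp
      finally show "(\<integral>\<^sup>+\<omega>'. ennreal (psi \<beta> \<gamma> t (f n (\<phi> \<omega>' a t))) \<partial>N)
        \<le> (\<integral>\<^sup>+b. ennreal (normal_density 0 (sqrt t) b) * ennreal (w (a + b)) \<partial>lborel)" .
    qed
    also have "\<dots> \<le> scbm_laplace \<beta> \<gamma> N \<phi> t (f n) (Z s \<omega>)"
      unfolding scbm_laplace_def
      by (rule lap_double_integral_le[OF flow _ scbm_radon[OF s \<omega>]]) (use t psi_le in auto)
    finally show ?thesis .
  qed
  \<comment> \<open>A truncated barrier is bounded with bounded support, so its integral against a
    Radon measure is finite and \<open>lap\<close> agrees with the Bochner form of the Markov
    formula.\<close>
  have exp_eq: "exp (- (\<integral>x. f n x \<partial>Z (s + t) \<omega>)) = lap (\<integral>\<^sup>+x. ennreal (f n x) \<partial>Z (s + t) \<omega>)"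
    if \<omega>: "\<omega> \<in> space M" for \<omega> n
  proof -
    have rad: "radon (Z (s + t) \<omega>)" using s t \<omega> by (intro scbm_radon) auto
    then have [measurable_cong, simp]: "sets (Z (s + t) \<omega>) = sets borel" by (simp add: radon_def)
    have "(\<integral>\<^sup>+x. ennreal (f n x) \<partial>Z (s + t) \<omega>)
        \<le> (\<integral>\<^sup>+x. ennreal (\<eta> powr (- (1 / \<beta>))) * indicator {- real n..real n} x \<partial>Z (s + t) \<omega>)"
      by (intro nn_integral_mono) (auto simp: f_def indicator_def intro!: ennreal_leI v_le)
    also have "\<dots> = ennreal (\<eta> powr (- (1 / \<beta>))) * emeasure (Z (s + t) \<omega>) {- real n..real n}"
      by (rule nn_integral_cmult_indicator) simp
    also have "\<dots> < \<top>" using rad by (simp add: radon_def ennreal_mult_less_top)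
    finally have "(\<integral>\<^sup>+x. ennreal (f n x) \<partial>Z (s + t) \<omega>) \<noteq> \<top>" by simp
    moreover have "(\<integral>x. f n x \<partial>Z (s + t) \<omega>) = enn2real (\<integral>\<^sup>+x. ennreal (f n x) \<partial>Z (s + t) \<omega>)"
      by (rule integral_eq_nn_integral) (auto simp: f0)
    ultimately show ?thesis by (simp add: lap_def)
  qed
  have markov: "(\<integral>\<omega>\<in>A. exp (- (\<integral>x. f n x \<partial>Z (s + t) \<omega>)) \<partial>M)
           = (\<integral>\<omega>\<in>A. scbm_laplace \<beta> \<gamma> N \<phi> t (f n) (Z s \<omega>) \<partial>M)" for n
    using scbm s t test[of n] A unfolding scbm_def by auto
  have exp_int: "(\<integral>\<omega>\<in>A. exp (- (\<integral>x. f n x \<partial>Z (s + t) \<omega>)) \<partial>M)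
      = (\<integral>\<omega>. indicator A \<omega> * lap (\<integral>\<^sup>+x. ennreal (f n x) \<partial>Z (s + t) \<omega>) \<partial>M)" for n
    unfolding set_lebesgue_integral_def by (intro Bochner_Integration.integral_cong) (auto simp: exp_eq)
  have int: "integrable M (\<lambda>\<omega>. indicator A \<omega> * lap (G \<omega>))"
    if "(\<lambda>\<omega>. lap (G \<omega>)) \<in> borel_measurable M" for G
    using that by (intro integrable_const_bound[of _ 1]) (auto simp: indicator_def)
  have Y_int: "integrable M (\<lambda>\<omega>. indicator A \<omega> * Y \<omega>)"
    using Y_meas unfolding Y_def by (rule int)
  have bound: "(\<integral>\<omega>. indicator A \<omega> * Y \<omega> \<partial>M)
      \<le> (\<integral>\<omega>. indicator A \<omega> * lap (\<integral>\<^sup>+x. ennreal (f n x) \<partial>Z (s + t) \<omega>) \<partial>M)" for n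
  proof (cases "integrable M (\<lambda>\<omega>. indicator A \<omega> *\<^sub>R scbm_laplace \<beta> \<gamma> N \<phi> t (f n) (Z s \<omega>))")
    case True
    have "(\<integral>\<omega>. indicator A \<omega> * Y \<omega> \<partial>M) \<le> (\<integral>\<omega>. indicator A \<omega> *\<^sub>R scbm_laplace \<beta> \<gamma> N \<phi> t (f n) (Z s \<omega>) \<partial>M)"
      by (rule integral_mono[OF Y_int True]) (auto simp: indicator_def laplace_ge)
    then show ?thesis using markov[of n] exp_int[of n] by (simp add: set_lebesgue_integral_def)
  next
    \<comment> \<open>The integral of a non-integrable Laplace functional is the junk value 0, so the Markov
      property makes \<open>A\<close> a null set.\<close>
    case False
    let ?g = "\<lambda>\<omega>. indicator A \<omega> * lap (\<integral>\<^sup>+x. ennreal (f n x) \<partial>Z (s + t) \<omega>)"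
    have "(\<integral>\<omega>. ?g \<omega> \<partial>M) = 0"
      using markov[of n] exp_int[of n] not_integrable_integral_eq[OF False] by (simp add: set_lebesgue_integral_def)
    then have "AE \<omega> in M. ?g \<omega> = 0"
      by (subst (asm) integral_nonneg_eq_0_iff_AE) (auto intro!: int L_meas)
    then have "AE \<omega> in M. indicator A \<omega> * Y \<omega> = 0"
    proof eventually_elim
      case (elim \<omega>)
      show ?case
      proof (cases "\<omega> \<in> A")
        case True
        then have "\<omega> \<in> space M" using sets.sets_into_space[OF AM] by auto
        from exp_eq[OF this, of n] elim True show ?thesis by simp
      qed simp
    qed
    then have "(\<integral>\<omega>. indicator A \<omega> * Y \<omega> \<partial>M) = 0" by (rule integral_eq_zero_AE)
    then show ?thesis by (simp add: integral_nonneg)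
  qed
  have "(\<lambda>n. \<integral>\<omega>. indicator A \<omega> * lap (\<integral>\<^sup>+x. ennreal (f n x) \<partial>Z (s + t) \<omega>) \<partial>M)
      \<longlonglongrightarrow> (\<integral>\<omega>. indicator A \<omega> * lap (\<integral>\<^sup>+x. ennreal (v x) \<partial>Z (s + t) \<omega>) \<partial>M)"
  proof (rule integral_dominated_convergence[where w = "\<lambda>_. 1"])
    show "AE \<omega> in M. (\<lambda>n. indicator A \<omega> * lap (\<integral>\<^sup>+x. ennreal (f n x) \<partial>Z (s + t) \<omega>))
        \<longlonglongrightarrow> indicator A \<omega> * lap (\<integral>\<^sup>+x. ennreal (v x) \<partial>Z (s + t) \<omega>)"
    proof (intro AE_I2 tendsto_mult tendsto_const tendsto_lap nn_integral_LIMSEQ)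
      fix \<omega> assume "\<omega> \<in> space M"
      then have "radon (Z (s + t) \<omega>)" using s t by (intro scbm_radon) auto
      then have [measurable_cong]: "sets (Z (s + t) \<omega>) = sets borel" by (simp add: radon_def)
      show "(\<lambda>x. ennreal (f n x)) \<in> borel_measurable (Z (s + t) \<omega>)" for n by measurable
      show "incseq (\<lambda>n x. ennreal (f n x))"
        by (auto simp: incseq_def le_fun_def f_def indicator_def v0 intro!: ennreal_leI)
      show "(\<lambda>n. ennreal (f n x)) \<longlonglongrightarrow> ennreal (v x)" for x
      proof (rule tendsto_eventually)
        obtain n0 :: nat where "\<bar>x\<bar> \<le> real n0" using real_arch_simple by blast
        then show "\<forall>\<^sub>F n in sequentially. ennreal (f n x) = ennreal (v x)"
          by (intro eventually_sequentiallyI[of n0]) (auto simp: f_def indicator_def)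
      qed
    qed
    show "AE \<omega> in M. norm (indicator A \<omega> * lap (\<integral>\<^sup>+x. ennreal (f n x) \<partial>Z (s + t) \<omega>)) \<le> 1" for n
      by (auto simp: indicator_def)
  qed (auto intro!: borel_measurable_times L_meas)
  then have "(\<integral>\<omega>. indicator A \<omega> * Y \<omega> \<partial>M) \<le> (\<integral>\<omega>. indicator A \<omega> * lap (\<integral>\<^sup>+x. ennreal (v x) \<partial>Z (s + t) \<omega>) \<partial>M)"
    by (rule LIMSEQ_le_const) (auto intro: bound)
  then show ?thesis by (simp add: set_lebesgue_integral_def Y_def)
qed

text \<open>The supersolution inequality is reversed by the antitone \<open>lap\<close>: Laplace
  functionals of the barrier increase in mean on each event of the past, so their complements to 1
  form a supermartingale.\<close>

lemma scbm_lap_barrier_submartingale: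
  fixes D R \<eta> s t :: real
  assumes D: "0 < D" and \<eta>: "0 < \<eta>" and s: "0 \<le> s" and t: "0 < t"
    and super: "\<And>x. (\<integral>\<^sup>+b. ennreal (normal_density 0 (sqrt t) b) *
        ennreal (barrier (1 / \<beta>) D R (\<eta> + \<gamma> * \<beta> / (1 + \<beta>) * t) (x + b)) \<partial>lborel) \<le> ennreal (barrier (1 / \<beta>) D R \<eta> x)"
    and A: "A \<in> sets (nat_filtration M Z s)"
  shows "(\<integral>\<omega>\<in>A. lap (\<integral>\<^sup>+x. ennreal (barrier (1 / \<beta>) D R \<eta> x) \<partial>Z s \<omega>) \<partial>M)
    \<le> (\<integral>\<omega>\<in>A. lap (\<integral>\<^sup>+x. ennreal (barrier (1 / \<beta>) D R \<eta> x) \<partial>Z (s + t) \<omega>) \<partial>M)"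
proof -
  interpret prob_space M by (rule scbm_prob_space)
  let ?H = "\<lambda>a. \<integral>\<^sup>+b. ennreal (normal_density 0 (sqrt t) b) *
        ennreal (barrier (1 / \<beta>) D R (\<eta> + \<gamma> * \<beta> / (1 + \<beta>) * t) (a + b)) \<partial>lborel"
  have AM [measurable]: "A \<in> sets M" using A nat_filtration_subset by blast
  have int: "set_integrable M A (\<lambda>\<omega>. lap (\<integral>\<^sup>+x. h x \<partial>Z s \<omega>))" if "h \<in> borel_measurable borel" for h
    unfolding set_integrable_def
    using nn_integral_scbm_measurable[OF s that]
    by (intro integrable_const_bound[of _ 1])
      (auto simp: indicator_def intro!: borel_measurable_scaleR measurable_compose[OF _ lap_measurable])
  have "(\<integral>\<omega>\<in>A. lap (\<integral>\<^sup>+x. ennreal (barrier (1 / \<beta>) D R \<eta> x) \<partial>Z s \<omega>) \<partial>M) \<le> (\<integral>\<omega>\<in>A. lap (\<integral>\<^sup>+a. ?H a \<partial>Z s \<omega>) \<partial>M)"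
    by (intro set_integral_mono int lap_antimono nn_integral_mono super) measurable
  also have "\<dots> \<le> (\<integral>\<omega>\<in>A. lap (\<integral>\<^sup>+x. ennreal (barrier (1 / \<beta>) D R \<eta> x) \<partial>Z (s + t) \<omega>) \<partial>M)"
    by (rule scbm_lap_barrier_ge[OF D \<eta> s t A])
  finally show ?thesis .
qed

end

end

section \<open>The process started from Lebesgue measure\<close>

text \<open>Tonelli and translation invariance. For a Gaussian density this says that Brownian
  motion preserves Lebesgue measure, so the spatial motion leaves the total integral of the evolved
  barrier unchanged.\<close>

lemma nn_integral_convolution_density:
  fixes n :: "real \<Rightarrow> ennreal" and w :: "real \<Rightarrow> ennreal"
  assumes [measurable]: "n \<in> borel_measurable borel" "w \<in> borel_measurable borel"
  shows "(\<integral>\<^sup>+a. (\<integral>\<^sup>+b. n b * w (a + b) \<partial>lborel) \<partial>lborel) = (\<integral>\<^sup>+b. n b \<partial>lborel) * (\<integral>\<^sup>+a. w a \<partial>lborel)"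
proof -
  have "(\<integral>\<^sup>+a. (\<integral>\<^sup>+b. n b * w (a + b) \<partial>lborel) \<partial>lborel) = (\<integral>\<^sup>+b. (\<integral>\<^sup>+a. n b * w (a + b) \<partial>lborel) \<partial>lborel)"
    by (rule lborel_pair.Fubini') measurable
  also have "\<dots> = (\<integral>\<^sup>+b. n b * (\<integral>\<^sup>+a. w a \<partial>lborel) \<partial>lborel)"
  proof (rule nn_integral_cong)
    fix b
    have "(\<integral>\<^sup>+a. w a \<partial>lborel) = (\<integral>\<^sup>+a. w (a + b) \<partial>lborel)"
      using nn_integral_real_affine[of w 1 b] by (simp add: add.commute)
    then show "(\<integral>\<^sup>+a. n b * w (a + b) \<partial>lborel) = n b * (\<integral>\<^sup>+a. w a \<partial>lborel)"
      by (simp add: nn_integral_cmult)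
  qed
  also have "\<dots> = (\<integral>\<^sup>+b. n b \<partial>lborel) * (\<integral>\<^sup>+a. w a \<partial>lborel)"
    by (rule nn_integral_multc) measurable
  finally show ?thesis .
qed

text \<open>\<open>Z 0\<close> is deterministic, so Jensen's bound is the constant
  \<open>lap c\<close>, and \<open>1 - lap c \<le> c\<close> reduces everything to the Lebesgue
  integral of the evolved barrier. Its \<open>\<eta>\<close>-free estimate lets the barrier become
  arbitrarily high without worsening the bound.\<close>

lemma scbm_initial_bound:
  fixes D R \<eta> s :: real
  assumes \<beta>: "0 < \<beta>" "\<beta> \<le> 1" and \<gamma>: "0 < \<gamma>" and flow: "arratia_flow N \<phi>"
    and scbm: "scbm \<beta> \<gamma> N \<phi> M Z lborel"
    and D: "0 < D" and R: "0 \<le> R" and \<eta>: "0 < \<eta>" and s: "0 < s"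
  shows "(\<integral>\<omega>. 1 - lap (\<integral>\<^sup>+x. ennreal (barrier (1 / \<beta>) D R \<eta> x) \<partial>Z s \<omega>) \<partial>M)
    \<le> 2 * ((\<gamma> * \<beta> / (1 + \<beta>)) powr (- (1 / \<beta>)) + D powr (- (1 / \<beta>))) * (R + sqrt s) * s powr (- (1 / \<beta>))"
proof -
  interpret prob_space M by (rule scbm_prob_space[OF scbm])
  define \<kappa> where "\<kappa> = \<gamma> * \<beta> / (1 + \<beta>)"
  have \<kappa>: "0 < \<kappa>" using \<beta> \<gamma> by (simp add: \<kappa>_def)
  define C where "C = 2 * (\<kappa> powr (- (1 / \<beta>)) + D powr (- (1 / \<beta>))) * (R + sqrt s) * s powr (- (1 / \<beta>))"
  have C: "0 \<le> C" using R s by (simp add: C_def)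
  let ?n = "\<lambda>b. ennreal (normal_density 0 (sqrt s) b)"
  let ?w = "\<lambda>x. ennreal (barrier (1 / \<beta>) D R (\<eta> + \<kappa> * s) x)"
  define c where "c = (\<integral>\<^sup>+a. (\<integral>\<^sup>+b. ?n b * ?w (a + b) \<partial>lborel) \<partial>lborel)"
  have "c = (\<integral>\<^sup>+b. ?n b \<partial>lborel) * (\<integral>\<^sup>+a. ?w a \<partial>lborel)"
    unfolding c_def by (rule nn_integral_convolution_density) measurable
  also have "(\<integral>\<^sup>+b. ?n b \<partial>lborel) = 1"
    using normal_moment_even[of "sqrt s" 0 0] s
    by (subst nn_integral_eq_integral) (auto simp: has_bochner_integral_iff)
  also have "1 * (\<integral>\<^sup>+a. ?w a \<partial>lborel) \<le> ennreal C"
    unfolding C_def mult_1 using \<beta> \<eta> by (intro nn_integral_barrier_le D \<kappa> R s) auto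
  finally have "c \<le> ennreal C" .
  with one_minus_lap_le[of c] have "ennreal (1 - lap c) \<le> ennreal C" by (rule order_trans)
  then have lap_c: "1 - lap c \<le> C" using C by (simp add: ennreal_le_iff)
  have sp: "space M \<in> sets (nat_filtration M Z 0)"
    using sets.top[of "nat_filtration M Z 0"] by (simp add: space_nat_filtration)
  have L [measurable]: "(\<lambda>\<omega>. lap (\<integral>\<^sup>+x. ennreal (barrier (1 / \<beta>) D R \<eta> x) \<partial>Z s \<omega>)) \<in> borel_measurable M"
    using s by (intro measurable_compose[OF nn_integral_scbm_measurable[OF scbm] lap_measurable]) auto
  have "lap c = (\<integral>\<omega>\<in>space M. lap (\<integral>\<^sup>+a. (\<integral>\<^sup>+b. ?n b * ?w (a + b) \<partial>lborel) \<partial>Z 0 \<omega>) \<partial>M)"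
  proof -
    have "(\<integral>\<omega>\<in>space M. lap (\<integral>\<^sup>+a. (\<integral>\<^sup>+b. ?n b * ?w (a + b) \<partial>lborel) \<partial>Z 0 \<omega>) \<partial>M) = (\<integral>\<omega>. lap c \<partial>M)"
      unfolding set_lebesgue_integral_def c_def
      using scbm by (intro Bochner_Integration.integral_cong) (auto simp: scbm_def)
    then show ?thesis by (simp add: prob_space)
  qed
  also have "\<dots> \<le> (\<integral>\<omega>\<in>space M. lap (\<integral>\<^sup>+x. ennreal (barrier (1 / \<beta>) D R \<eta> x) \<partial>Z (0 + s) \<omega>) \<partial>M)"
    unfolding \<kappa>_def by (rule scbm_lap_barrier_ge[OF scbm \<beta>(1) \<gamma> flow D \<eta> order_refl s sp])
  also have "\<dots> = (\<integral>\<omega>. lap (\<integral>\<^sup>+x. ennreal (barrier (1 / \<beta>) D R \<eta> x) \<partial>Z s \<omega>) \<partial>M)"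
    unfolding set_lebesgue_integral_def by (intro Bochner_Integration.integral_cong) auto
  finally have "1 - (\<integral>\<omega>. lap (\<integral>\<^sup>+x. ennreal (barrier (1 / \<beta>) D R \<eta> x) \<partial>Z s \<omega>) \<partial>M) \<le> C"
    using lap_c by linarith
  moreover have "integrable M (\<lambda>\<omega>. lap (\<integral>\<^sup>+x. ennreal (barrier (1 / \<beta>) D R \<eta> x) \<partial>Z s \<omega>))"
    by (rule integrable_const_bound[of _ 1]) auto
  ultimately show ?thesis by (simp add: C_def \<kappa>_def prob_space)
qed

text \<open>The exceptional set is the increasing limit of the events \<open>E j\<close>, in which
  the time grid is refined and the mass threshold lowered together. Each has probability at most
  \<open>2 * C\<close>, so the limit has too, and it covers the uncountably many times without any
  measurability claim about their union.\<close>

lemma scbm_no_mass_bound: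
  fixes D R s :: real
  assumes \<beta>: "0 < \<beta>" "\<beta> \<le> 1" and \<gamma>: "0 < \<gamma>" and flow: "arratia_flow N \<phi>"
    and scbm: "scbm \<beta> \<gamma> N \<phi> M Z lborel"
    and D: "0 < D" and super: "\<And>R \<eta> r x. 0 < \<eta> \<Longrightarrow> 0 < r \<Longrightarrow>
      (\<integral>\<^sup>+b. ennreal (normal_density 0 (sqrt r) b) *
        ennreal (barrier (1 / \<beta>) D R (\<eta> + \<gamma> * \<beta> / (1 + \<beta>) * r) (x + b)) \<partial>lborel) \<le> ennreal (barrier (1 / \<beta>) D R \<eta> x)"
    and R: "0 \<le> R" and s: "0 < s"
  shows "\<exists>E\<in>sets M. measure M E \<le> 4 * ((\<gamma> * \<beta> / (1 + \<beta>)) powr (- (1 / \<beta>)) + D powr (- (1 / \<beta>)))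
        * (R + 1 + sqrt s) * s powr (- (1 / \<beta>))
      \<and> (\<forall>\<omega>\<in>space M - E. \<forall>t\<ge>s. emeasure (Z t \<omega>) {- R..R} = 0)"
proof -
  interpret prob_space M by (rule scbm_prob_space[OF scbm])
  define C where "C = 2 * ((\<gamma> * \<beta> / (1 + \<beta>)) powr (- (1 / \<beta>)) + D powr (- (1 / \<beta>)))
    * (R + 1 + sqrt s) * s powr (- (1 / \<beta>))"
  \<comment> \<open>A continuous trapezoid between the indicators of the intervals of radius
    \<open>R\<close> and \<open>R + 1\<close>, to which the path regularity applies; its support is
    the reason for \<open>R + 1\<close> in the bound.\<close>
  define f where "f x = max 0 (1 - max 0 (\<bar>x\<bar> - R))" for x
  have f_meas [measurable]: "f \<in> borel_measurable borel" unfolding f_def by measurable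
  have f0: "0 \<le> f x" and f1: "f x \<le> indicator {- (R + 1)..R + 1} x" and f_ind: "indicator {- R..R} x \<le> f x" for x
    by (auto simp: f_def indicator_def abs_if)
  have f_cont: "continuous_on UNIV f" unfolding f_def by (intro continuous_intros)
  have f_supp: "bounded {x. f x \<noteq> 0}"
    by (rule bounded_subset[of "{- (R + 1)..R + 1}"]) (auto simp: f_def max_def abs_if split: if_splits)
  define I where "I r \<omega> = (\<integral>x. f x \<partial>Z r \<omega>)" for r \<omega>
  have I: "ennreal (I r \<omega>) = (\<integral>\<^sup>+x. ennreal (f x) \<partial>Z r \<omega>)" if r: "0 \<le> r" and \<omega>: "\<omega> \<in> space M" for r \<omega>
  proof -
    have rad: "radon (Z r \<omega>)" by (rule scbm_radon[OF scbm r \<omega>])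
    then have [measurable_cong, simp]: "sets (Z r \<omega>) = sets borel" by (simp add: radon_def)
    have "(\<integral>\<^sup>+x. ennreal (f x) \<partial>Z r \<omega>) \<le> (\<integral>\<^sup>+x. indicator {- (R + 1)..R + 1} x \<partial>Z r \<omega>)"
    proof (rule nn_integral_mono)
      fix x
      show "ennreal (f x) \<le> indicator {- (R + 1)..R + 1} x"
        using ennreal_leI[OF f1[of x]] by (simp add: ennreal_indicator)
    qed
    also have "\<dots> = emeasure (Z r \<omega>) {- (R + 1)..R + 1}" by simp
    also have "\<dots> < \<top>" using rad by (simp add: radon_def)
    finally have "(\<integral>\<^sup>+x. ennreal (f x) \<partial>Z r \<omega>) < \<top>" .
    moreover have "I r \<omega> = enn2real (\<integral>\<^sup>+x. ennreal (f x) \<partial>Z r \<omega>)"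
      unfolding I_def by (rule integral_eq_nn_integral) (auto simp: f0)
    ultimately show ?thesis by simp
  qed
  have I_meas: "I r \<in> borel_measurable M" if r: "0 \<le> r" for r
  proof -
    have "(\<lambda>\<omega>. enn2real (\<integral>\<^sup>+x. ennreal (f x) \<partial>Z r \<omega>)) \<in> borel_measurable M"
      using nn_integral_scbm_measurable[OF scbm r, of "\<lambda>x. ennreal (f x)"] by measurable
    moreover have "I r \<omega> = enn2real (\<integral>\<^sup>+x. ennreal (f x) \<partial>Z r \<omega>)" if "\<omega> \<in> space M" for \<omega>
      using I[OF r that] by (metis I_def enn2real_ennreal f0 Bochner_Integration.integral_nonneg)
    ultimately show ?thesis by (subst measurable_cong)
  qed
  define tm where "tm j k = s + real k / 2 ^ j" for j k :: nat
  have tm: "0 \<le> tm j k" for j k using s by (simp add: tm_def)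
  define E where "E j = {\<omega>\<in>space M. \<exists>k. 1 / real (Suc j) < I (tm j k) \<omega>}" for j
  have E_sets [measurable]: "E j \<in> sets M" for j
  proof -
    note [measurable] = I_meas[OF tm]
    show ?thesis unfolding E_def by measurable
  qed
  have E_le: "measure M (E j) \<le> 2 * C" for j
  proof -
    \<comment> \<open>The barrier then has height \<open>Suc j\<close> on the support of
      \<open>f\<close>, so a value of \<open>I\<close> above \<open>1 / Suc j\<close> forces its
      integral to be at least 1. Hence \<open>X\<close> is at least \<open>1 - exp (- 1)\<close>,
      which exceeds the level \<open>1 / 2\<close>.\<close>
    define \<eta> where "\<eta> = real (Suc j) powr (- \<beta>)"
    have \<eta>: "0 < \<eta>" and \<eta>_powr: "\<eta> powr (- (1 / \<beta>)) = real (Suc j)"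
      using \<beta> by (auto simp: \<eta>_def powr_powr)
    let ?v = "barrier (1 / \<beta>) D (R + 1) \<eta>"
    define X where "X k \<omega> = 1 - lap (\<integral>\<^sup>+x. ennreal (?v x) \<partial>Z (tm j k) \<omega>)" for k \<omega>
    let ?F = "\<lambda>k. nat_filtration M Z (tm j k)"
    have XF: "X k \<in> borel_measurable (?F k)" for k
      unfolding X_def
      by (intro borel_measurable_diff borel_measurable_const
          measurable_compose[OF nn_integral_scbm_measurable_filtration[OF scbm] lap_measurable] tm) auto
    have LM: "(\<lambda>\<omega>. lap (\<integral>\<^sup>+x. ennreal (?v x) \<partial>Z (tm j k) \<omega>)) \<in> borel_measurable M" for k
      by (intro measurable_compose[OF nn_integral_scbm_measurable[OF scbm] lap_measurable] tm) auto
    have XM [measurable]: "X k \<in> borel_measurable M" for k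
      unfolding X_def using LM by measurable
    have tm_Suc: "tm j (Suc k) = tm j k + 1 / 2 ^ j" for k by (simp add: tm_def add_divide_distrib)
    have "1 / 2 * measure M {\<omega>\<in>space M. \<exists>k. 1 / 2 \<le> X k \<omega>} \<le> (\<integral>\<omega>. X 0 \<omega> \<partial>M)"
    proof (rule maximal_inequality[where F = ?F])
      show "sets (?F k) \<subseteq> sets (?F (Suc k))" for k
        by (rule nat_filtration_mono) (simp add: tm_Suc)
      show "X k \<in> borel_measurable (?F k)" for k by (rule XF)
      fix k A assume A: "A \<in> sets (?F k)"
      then have AM: "A \<in> sets M" using nat_filtration_subset[OF scbm] by blast
      have sub: "(\<integral>\<omega>\<in>A. X i \<omega> \<partial>M) = measure M A - (\<integral>\<omega>\<in>A. lap (\<integral>\<^sup>+x. ennreal (?v x) \<partial>Z (tm j i) \<omega>) \<partial>M)" for i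
      proof -
        have "set_integrable M A (\<lambda>\<omega>. lap (\<integral>\<^sup>+x. ennreal (?v x) \<partial>Z (tm j i) \<omega>))"
          unfolding set_integrable_def using AM LM
          by (intro integrable_const_bound[of _ 1]) (auto simp: indicator_def)
        then have "(\<integral>\<omega>\<in>A. X i \<omega> \<partial>M) = (\<integral>\<omega>\<in>A. 1 \<partial>M) - (\<integral>\<omega>\<in>A. lap (\<integral>\<^sup>+x. ennreal (?v x) \<partial>Z (tm j i) \<omega>) \<partial>M)"
          unfolding X_def using AM by (intro set_integral_diff) (auto simp: set_integrable_def emeasure_eq_measure)
        then show ?thesis using AM by (simp add: set_lebesgue_integral_def)
      qed
      have "(\<integral>\<omega>\<in>A. lap (\<integral>\<^sup>+x. ennreal (?v x) \<partial>Z (tm j k) \<omega>) \<partial>M)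
          \<le> (\<integral>\<omega>\<in>A. lap (\<integral>\<^sup>+x. ennreal (?v x) \<partial>Z (tm j (Suc k)) \<omega>) \<partial>M)"
        unfolding tm_Suc using R
        by (intro scbm_lap_barrier_submartingale[OF scbm \<beta>(1) \<gamma> flow D \<eta> tm _ super A] \<eta>) auto
      then show "(\<integral>\<omega>\<in>A. X (Suc k) \<omega> \<partial>M) \<le> (\<integral>\<omega>\<in>A. X k \<omega> \<partial>M)" by (simp add: sub)
    qed (auto simp: X_def space_nat_filtration nat_filtration_subset[OF scbm] prob_space_axioms)
    also have "(\<integral>\<omega>. X 0 \<omega> \<partial>M) \<le> C"
      using scbm_initial_bound[OF \<beta> \<gamma> flow scbm D _ \<eta> s, of "R + 1"] R by (simp add: X_def tm_def C_def)
    finally have "measure M {\<omega>\<in>space M. \<exists>k. 1 / 2 \<le> X k \<omega>} \<le> 2 * C" by simp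
    moreover have "E j \<subseteq> {\<omega>\<in>space M. \<exists>k. 1 / 2 \<le> X k \<omega>}"
    proof
      fix \<omega> assume "\<omega> \<in> E j"
      then obtain k where \<omega>: "\<omega> \<in> space M" and k: "1 / real (Suc j) < I (tm j k) \<omega>" by (auto simp: E_def)
      have [measurable_cong]: "sets (Z (tm j k) \<omega>) = sets borel"
        using scbm_radon[OF scbm tm \<omega>] by (simp add: radon_def)
      have "ennreal 1 \<le> ennreal (real (Suc j) * I (tm j k) \<omega>)"
        using k by (intro ennreal_leI) (simp add: field_simps)
      also have "\<dots> = ennreal (real (Suc j)) * (\<integral>\<^sup>+x. ennreal (f x) \<partial>Z (tm j k) \<omega>)"
        using I[OF tm \<omega>, of j k] by (simp add: ennreal_mult' del: of_nat_Suc)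
      also have "\<dots> = (\<integral>\<^sup>+x. ennreal (real (Suc j)) * ennreal (f x) \<partial>Z (tm j k) \<omega>)"
        by (rule nn_integral_cmult[symmetric]) measurable
      also have "\<dots> \<le> (\<integral>\<^sup>+x. ennreal (?v x) \<partial>Z (tm j k) \<omega>)"
      proof (rule nn_integral_mono)
        fix x
        have "real (Suc j) * f x \<le> ?v x"
        proof (cases "\<bar>x\<bar> \<le> R + 1")
          case True
          have "real (Suc j) * f x \<le> real (Suc j) * 1"
            by (intro mult_left_mono) (auto simp: f_def)
          then show ?thesis using barrier_eq[OF True, of "1 / \<beta>" D \<eta>] \<eta>_powr by simp
        next
          case False
          then have "f x = 0" by (simp add: f_def)
          then show ?thesis by simp
        qed
        then show "ennreal (real (Suc j)) * ennreal (f x) \<le> ennreal (?v x)"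
          by (simp add: ennreal_mult'[symmetric] ennreal_leI f0 del: of_nat_Suc)
      qed
      finally have "lap (\<integral>\<^sup>+x. ennreal (?v x) \<partial>Z (tm j k) \<omega>) \<le> lap (ennreal 1)" by (rule lap_antimono)
      also have "\<dots> = exp (- 1)" by (simp add: lap_ennreal del: ennreal_1)
      also have "\<dots> \<le> 1 / 2" using exp_ge_add_one_self[of 1] by (simp add: exp_minus field_simps)
      finally show "\<omega> \<in> {\<omega>\<in>space M. \<exists>k. 1 / 2 \<le> X k \<omega>}" using \<omega> by (auto simp: X_def intro!: exI[of _ k])
    qed
    ultimately show ?thesis using finite_measure_mono[of "E j" "{\<omega>\<in>space M. \<exists>k. 1 / 2 \<le> X k \<omega>}"] by simp
  qed
  have "incseq E"
  proof (rule incseq_SucI, rule subsetI)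
    fix j \<omega> assume "\<omega> \<in> E j"
    then obtain k where \<omega>: "\<omega> \<in> space M" and k: "1 / real (Suc j) < I (tm j k) \<omega>" by (auto simp: E_def)
    \<comment> \<open>Halving the step keeps the old grid times, and the threshold decreases, so an
      event at level \<open>j\<close> persists at level \<open>Suc j\<close>.\<close>
    have "tm j k = tm (Suc j) (2 * k)" by (simp add: tm_def)
    moreover have "1 / real (Suc (Suc j)) \<le> 1 / real (Suc j)" by (simp add: frac_le)
    ultimately show "\<omega> \<in> E (Suc j)" using \<omega> k unfolding E_def by (auto intro!: exI[of _ "2 * k"])
  qed
  then have "(\<lambda>j. measure M (E j)) \<longlonglongrightarrow> measure M (\<Union>j. E j)"
    by (intro finite_Lim_measure_incseq) auto
  then have bound: "measure M (\<Union>j. E j) \<le> 2 * C"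
    by (rule LIMSEQ_le_const2) (use E_le in auto)
  have "emeasure (Z t \<omega>) {- R..R} = 0" if \<omega>: "\<omega> \<in> space M - (\<Union>j. E j)" and t: "s \<le> t" for \<omega> t
  proof (rule ccontr)
    assume nz: "emeasure (Z t \<omega>) {- R..R} \<noteq> 0"
    have t0: "0 \<le> t" and \<omega>M: "\<omega> \<in> space M" using s t \<omega> by auto
    have [measurable_cong, simp]: "sets (Z t \<omega>) = sets borel"
      using scbm_radon[OF scbm t0 \<omega>M] by (simp add: radon_def)
    have "emeasure (Z t \<omega>) {- R..R} = (\<integral>\<^sup>+x. indicator {- R..R} x \<partial>Z t \<omega>)" by simp
    also have "\<dots> \<le> (\<integral>\<^sup>+x. ennreal (f x) \<partial>Z t \<omega>)"
    proof (rule nn_integral_mono)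
      fix x
      show "indicator {- R..R} x \<le> ennreal (f x)"
        using ennreal_leI[OF f_ind[of x]] by (simp add: ennreal_indicator)
    qed
    finally have "ennreal (I t \<omega>) \<noteq> 0" using nz I[OF t0 \<omega>M] by auto
    then have pos: "0 < I t \<omega>" by (auto simp: ennreal_eq_0_iff not_le)
    have "cadlag_on_nonneg (\<lambda>r. I r \<omega>)"
      unfolding I_def using scbm \<omega>M f_cont f0 f_supp unfolding scbm_def by blast
    then have "((\<lambda>r. I r \<omega>) \<longlongrightarrow> I t \<omega>) (at_right t)"
      using t0 by (simp add: cadlag_on_nonneg_def continuous_within)
    \<comment> \<open>Mass at \<open>t\<close> persists on a short interval to the right, which a
      fine enough grid must meet; halving leaves room above the threshold.\<close>
    then have "\<forall>\<^sub>F r in at_right t. I t \<omega> / 2 < I r \<omega>"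
      using pos by (intro order_tendstoD) auto
    then obtain d where d: "t < d" "\<And>r. t < r \<Longrightarrow> r < d \<Longrightarrow> I t \<omega> / 2 < I r \<omega>"
      unfolding eventually_at_right_field by auto
    obtain j1 :: nat where j1: "inverse (real (Suc j1)) < I t \<omega> / 2"
      using pos reals_Archimedean[of "I t \<omega> / 2"] by auto
    obtain j2 :: nat where j2: "(1 / 2) ^ j2 < d - t"
      using d(1) real_arch_pow_inv[of "d - t" "1 / 2"] by auto
    define j where "j = max j1 j2"
    have j_d: "1 / 2 ^ j < d - t"
    proof -
      have "(1 / 2 :: real) ^ j \<le> (1 / 2) ^ j2" by (intro power_decreasing) (auto simp: j_def)
      then show ?thesis using j2 by (simp add: power_one_over)
    qed
    have j_I: "1 / real (Suc j) < I t \<omega> / 2"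
    proof -
      have "1 / real (Suc j) \<le> 1 / real (Suc j1)" by (intro frac_le) (auto simp: j_def)
      then show ?thesis using j1 by (simp add: inverse_eq_divide)
    qed
    \<comment> \<open>The first grid time strictly after \<open>t\<close>; the strict inequality
      matters because \<open>d(2)\<close> controls only times to the right of
      \<open>t\<close>.\<close>
    define k where "k = nat \<lfloor>(t - s) * 2 ^ j\<rfloor> + 1"
    have "0 \<le> \<lfloor>(t - s) * 2 ^ j\<rfloor>" using t by simp
    then have "real k = real_of_int \<lfloor>(t - s) * 2 ^ j\<rfloor> + 1" by (simp add: k_def)
    then have "(t - s) * 2 ^ j < real k" "real k \<le> (t - s) * 2 ^ j + 1" by linarith+
    then have "t - s < real k / 2 ^ j" "real k / 2 ^ j \<le> ((t - s) * 2 ^ j + 1) / 2 ^ j"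
      by (auto simp: less_divide_eq intro: divide_right_mono)
    then have "t < tm j k" "tm j k \<le> t + 1 / 2 ^ j" by (auto simp: tm_def add_divide_distrib)
    then have "I t \<omega> / 2 < I (tm j k) \<omega>" using j_d by (intro d(2)) auto
    then have "\<omega> \<in> E j" using \<omega>M j_I by (auto simp: E_def intro!: exI[of _ k])
    then show False using \<omega> by auto
  qed
  moreover have "2 * C = 4 * ((\<gamma> * \<beta> / (1 + \<beta>)) powr (- (1 / \<beta>)) + D powr (- (1 / \<beta>)))
        * (R + 1 + sqrt s) * s powr (- (1 / \<beta>))"
    by (simp add: C_def)
  ultimately show ?thesis using bound by (intro bexI[of _ "\<Union>j. E j"]) auto
qed

section \<open>Dyadic summation and Borel-Cantelli\<close>

text \<open>On the block \<open>J n\<close> the integrand is at least \<open>c n\<close>: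
  monotonicity of \<open>g\<close> is used at the left end and decay of the power at the right end.
  The blocks are disjoint, so block length times \<open>c n\<close> sums to at most the
  integral.\<close>

lemma summable_dyadic_of_integral:
  fixes g :: "real \<Rightarrow> real" and p :: real
  assumes p: "0 \<le> p" and g0: "\<forall>t\<ge>0. 0 \<le> g t" and mono: "mono_on {0..} g"
    and fin: "(\<integral>\<^sup>+ y\<in>{1..}. ennreal (g y * y powr (-1 - p)) \<partial>lborel) < \<infinity>"
  shows "summable (\<lambda>n. g (2 ^ Suc n) * (2 ^ n) powr (- p))"
proof -
  define J where "J n = {2 ^ Suc n..<2 ^ Suc (Suc n) :: real}" for n :: nat
  define c where "c n = g (2 ^ Suc n) * (2 ^ Suc (Suc n)) powr (- 1 - p)" for n :: nat
  have c0: "0 \<le> c n" for n using g0 by (simp add: c_def)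
  have disj: "y \<notin> J m" if y: "y \<in> J n" and "m \<noteq> n" for y m n
  proof
    assume m: "y \<in> J m"
    have "False" if "m < n" "y \<in> J n" "y \<in> J m" for m n
    proof -
      have "(2::real) ^ Suc (Suc m) \<le> 2 ^ Suc n" using that(1) by (intro power_increasing) auto
      then show False using that by (auto simp: J_def)
    qed
    then show False using y m \<open>m \<noteq> n\<close> by (metis nat_neq_iff)
  qed
  have le: "(\<Sum>n. ennreal (c n) * indicator (J n) y) \<le> ennreal (g y * y powr (-1 - p)) * indicator {1..} y" for y
  proof (cases "\<exists>n. y \<in> J n")
    case True
    then obtain n where n: "y \<in> J n" by blast
    have y1: "1 \<le> y"
    proof -
      have "(1::real) \<le> 2 ^ Suc n" by (rule one_le_power) simp
      then show ?thesis using n by (auto simp: J_def)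
    qed
    have "ennreal (c m) * indicator (J m) y = (if m = n then ennreal (c n) else 0)" for m
      using n disj[OF n, of m] by (auto simp: indicator_def)
    then have "(\<Sum>m. ennreal (c m) * indicator (J m) y) = ennreal (c n)"
      using sums_single[of n "\<lambda>_. ennreal (c n)"] by (simp add: sums_iff)
    also have "c n \<le> g y * y powr (-1 - p)"
    proof -
      have y: "(2::real) ^ Suc n \<le> y" "y \<le> 2 ^ Suc (Suc n)" using n by (auto simp: J_def)
      have y0: "0 < y" using y(1) by (rule less_le_trans[rotated]) simp
      have "g (2 ^ Suc n) \<le> g y" using y y0 by (intro mono_onD[OF mono]) auto
      then show ?thesis unfolding c_def
        using y y0 g0 p by (intro mult_mono powr_mono2') auto
    qed
    finally show ?thesis using y1 by (simp add: ennreal_leI)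
  next
    case False
    then show ?thesis by simp
  qed
  have len: "emeasure lborel (J n) = ennreal (2 ^ Suc n)" for n
    by (simp add: J_def)
  have J_sets [measurable, simp]: "J n \<in> sets borel" for n
    by (simp add: J_def)
  have "(\<Sum>n. ennreal (c n * 2 ^ Suc n)) = (\<Sum>n. \<integral>\<^sup>+y. ennreal (c n) * indicator (J n) y \<partial>lborel)"
    by (intro suminf_cong) (simp add: nn_integral_cmult_indicator len c0 ennreal_mult del: power_Suc)
  also have "\<dots> = (\<integral>\<^sup>+y. (\<Sum>n. ennreal (c n) * indicator (J n) y) \<partial>lborel)"
    by (rule nn_integral_suminf[symmetric]) measurable
  also have "\<dots> \<le> (\<integral>\<^sup>+ y\<in>{1..}. ennreal (g y * y powr (-1 - p)) \<partial>lborel)"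
    by (intro nn_integral_mono le)
  finally have "(\<Sum>n. ennreal (c n * 2 ^ Suc n)) \<noteq> \<top>" using fin by (auto simp: top_unique)
  then have "summable (\<lambda>n. c n * 2 ^ Suc n)"
    using c0 by (intro summable_suminf_not_top) auto
  \<comment> \<open>The factor compensates for evaluating the power at \<open>4 * 2 ^ n\<close>
    instead of \<open>2 ^ n\<close>, against a block of length \<open>2 * 2 ^ n\<close>.\<close>
  then have "summable (\<lambda>n. (2 * 4 powr p) * (c n * 2 ^ Suc n))" by (rule summable_mult)
  also have "(\<lambda>n. (2 * 4 powr p) * (c n * 2 ^ Suc n)) = (\<lambda>n. g (2 ^ Suc n) * (2 ^ n) powr (- p))"
  proof
    fix n :: nat
    have "((2::real) ^ Suc (Suc n)) powr (- 1 - p) = (4 * 2 ^ n) powr (- 1) * (4 * 2 ^ n) powr (- p)"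
      by (subst powr_add[symmetric]) simp
    also have "\<dots> = 1 / (4 * 2 ^ n) * (4 powr (- p) * (2 ^ n) powr (- p))"
      by (simp add: powr_mult powr_minus_divide)
    finally show "(2 * 4 powr p) * (c n * 2 ^ Suc n) = g (2 ^ Suc n) * (2 ^ n) powr (- p)"
      by (simp add: c_def powr_minus_divide)
  qed
  finally show ?thesis .
qed

text \<open>Finiteness of the last charging time is boundedness of the set of charging times; the
  empty set is bounded, in accordance with the convention that its supremum is 0.\<close>

theorem theorem4p5:
  fixes \<beta> \<gamma> :: real and N :: "'b measure" and \<phi> :: "'b \<Rightarrow> real \<Rightarrow> real \<Rightarrow> real"
    and M :: "'a measure" and Z :: "real \<Rightarrow> 'a \<Rightarrow> real measure" and g :: "real \<Rightarrow> real"
  assumes "0 < \<beta>" and "\<beta> \<le> 1" and "0 < \<gamma>"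
    and "arratia_flow N \<phi>"
    and "scbm \<beta> \<gamma> N \<phi> M Z lborel"
    and "\<forall>t\<ge>0. 0 \<le> g t" and "mono_on {0..} g" and "\<forall>t\<ge>0. continuous (at_right t) g"
    and "(\<integral>\<^sup>+ y\<in>{1..}. ennreal (g y * y powr (-1 - 1 / \<beta>)) \<partial>lborel) < \<infinity>"
  shows "AE \<omega> in M. bdd_above {t. 0 \<le> t \<and> emeasure (Z t \<omega>) {- g t .. g t} \<noteq> 0}"
proof -
  interpret prob_space M using assms(5) by (simp add: scbm_def)
  define p where "p = 1 / \<beta>"
  define \<kappa> where "\<kappa> = \<gamma> * \<beta> / (1 + \<beta>)"
  have p: "1 \<le> p" and \<kappa>: "0 < \<kappa>" using assms(1-3) by (auto simp: p_def \<kappa>_def)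
  obtain D where D: "0 < D" and super: "\<And>R \<eta> r x. 0 < \<eta> \<Longrightarrow> 0 < r \<Longrightarrow>
      (\<integral>\<^sup>+b. ennreal (normal_density 0 (sqrt r) b) * ennreal (barrier p D R (\<eta> + \<kappa> * r) (x + b)) \<partial>lborel)
      \<le> ennreal (barrier p D R \<eta> x)"
    using barrier_supersolution[OF p \<kappa>] by auto
  define C where "C = 4 * (\<kappa> powr (- p) + D powr (- p))"
  have g: "0 \<le> g (2 ^ Suc n)" for n using assms(6) by simp
  have ex: "\<exists>E\<in>sets M. measure M E \<le> C * (g (2 ^ Suc n) + 1 + sqrt (2 ^ n)) * (2 ^ n) powr (- p)
      \<and> (\<forall>\<omega>\<in>space M - E. \<forall>t\<ge>2 ^ n. emeasure (Z t \<omega>) {- g (2 ^ Suc n)..g (2 ^ Suc n)} = 0)" for n :: nat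
    unfolding C_def p_def \<kappa>_def
    by (rule scbm_no_mass_bound[OF assms(1-5) D super[unfolded p_def \<kappa>_def] g]) auto
  have "\<exists>E. \<forall>n. E n \<in> sets M \<and> measure M (E n) \<le> C * (g (2 ^ Suc n) + 1 + sqrt (2 ^ n)) * (2 ^ n) powr (- p)
      \<and> (\<forall>\<omega>\<in>space M - E n. \<forall>t\<ge>2 ^ n. emeasure (Z t \<omega>) {- g (2 ^ Suc n)..g (2 ^ Suc n)} = 0)"
    by (rule choice, rule allI) (rule ex[unfolded Bex_def])
  then obtain E where E_all: "\<forall>n. E n \<in> sets M \<and> measure M (E n) \<le> C * (g (2 ^ Suc n) + 1 + sqrt (2 ^ n)) * (2 ^ n) powr (- p)
      \<and> (\<forall>\<omega>\<in>space M - E n. \<forall>t\<ge>2 ^ n. emeasure (Z t \<omega>) {- g (2 ^ Suc n)..g (2 ^ Suc n)} = 0)"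
    by (rule exE)
  have E [measurable]: "E n \<in> sets M"
    and E_le: "measure M (E n) \<le> C * (g (2 ^ Suc n) + 1 + sqrt (2 ^ n)) * (2 ^ n) powr (- p)"
    and E_zero: "\<omega> \<in> space M - E n \<Longrightarrow> 2 ^ n \<le> t \<Longrightarrow> emeasure (Z t \<omega>) {- g (2 ^ Suc n)..g (2 ^ Suc n)} = 0"
    for n \<omega> t
    using E_all[THEN spec, of n] by blast+
  have "summable (\<lambda>n. measure M (E n))"
  proof (rule summable_comparison_test')
    \<comment> \<open>The radius part is controlled by the integral test on \<open>g\<close>. The
      diffusive part, including the extra unit of radius, is dominated by a geometric series of
      ratio \<open>1 / sqrt 2\<close>.\<close>
    show "summable (\<lambda>n. C * (g (2 ^ Suc n) * (2 ^ n) powr (- p)) + C * (2 * (1 / sqrt 2) ^ n))"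
    proof (rule summable_add)
      show "summable (\<lambda>n. C * (g (2 ^ Suc n) * (2 ^ n) powr (- p)))"
        using p assms(1,6,7,9) by (intro summable_mult[of _ C] summable_dyadic_of_integral) (simp_all add: p_def)
      have "summable (\<lambda>n. (1 / sqrt 2) ^ n)" by (rule summable_geometric) simp
      then show "summable (\<lambda>n. C * (2 * (1 / sqrt 2) ^ n))" by (simp only: summable_mult)
    qed
    fix n :: nat
    have C: "0 \<le> C" by (simp add: C_def)
    have "(1 + sqrt (2 ^ n)) * (2 ^ n) powr (- p) \<le> (2 * sqrt (2 ^ n)) * (2 ^ n) powr (- 1)"
      using p by (intro mult_mono powr_mono) auto
    also have "\<dots> = 2 * (sqrt (2 ^ n) / 2 ^ n)" by (simp add: powr_minus_divide)
    also have "sqrt (2 ^ n) / 2 ^ n = 1 / sqrt (2 ^ n)"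
      by (simp add: field_simps)
    also have "\<dots> = (1 / sqrt 2) ^ n" by (simp add: real_sqrt_power power_one_over)
    finally have "C * ((1 + sqrt (2 ^ n)) * (2 ^ n) powr (- p)) \<le> C * (2 * (1 / sqrt 2) ^ n)"
      using C by (rule mult_left_mono)
    then have "measure M (E n) \<le> C * (g (2 ^ Suc n) * (2 ^ n) powr (- p)) + C * (2 * (1 / sqrt 2) ^ n)"
      using E_le[of n] by (simp add: algebra_simps)
    then show "norm (measure M (E n)) \<le> C * (g (2 ^ Suc n) * (2 ^ n) powr (- p)) + C * (2 * (1 / sqrt 2) ^ n)"
      by simp
  qed
  then have "AE \<omega> in M. \<forall>\<^sub>F n in sequentially. \<omega> \<in> space M - E n"
    by (intro borel_cantelli_AE1) (auto simp: emeasure_eq_measure)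
  then show ?thesis
  proof eventually_elim
    case (elim \<omega>)
    then obtain n0 where n0: "\<And>n. n0 \<le> n \<Longrightarrow> \<omega> \<in> space M - E n" by (auto simp: eventually_sequentially)
    show ?case
    proof (rule bdd_aboveI)
      fix t assume t: "t \<in> {t. 0 \<le> t \<and> emeasure (Z t \<omega>) {- g t .. g t} \<noteq> 0}"
      show "t \<le> 2 ^ n0"
      proof (rule ccontr)
        assume "\<not> t \<le> 2 ^ n0"
        then have t_gt: "2 ^ n0 < t" by simp
        have "\<exists>m. t < 2 ^ m" by (rule real_arch_pow) simp
        \<comment> \<open>With \<open>m = Suc n\<close>, the time \<open>t\<close> lies in the block
          from \<open>2 ^ n\<close> to \<open>2 ^ Suc n\<close>. Hence \<open>g t\<close> is at most
          the radius \<open>g (2 ^ Suc n)\<close> that was excluded for all times from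
          \<open>2 ^ n\<close> on.\<close>
        define m where "m = (LEAST m. t < 2 ^ m)"
        have m: "t < 2 ^ m" unfolding m_def using \<open>\<exists>m. t < 2 ^ m\<close> by (rule LeastI_ex)
        have "n0 < m"
        proof (rule ccontr)
          assume "\<not> n0 < m"
          then have "(2::real) ^ m \<le> 2 ^ n0" by (intro power_increasing) auto
          then show False using m t_gt by linarith
        qed
        then obtain n where n: "m = Suc n" "n0 \<le> n" by (cases m) auto
        have "\<not> t < 2 ^ n" using not_less_Least[of n "\<lambda>m. t < 2 ^ m"] n(1) by (simp add: m_def)
        then have tn: "2 ^ n \<le> t" by simp
        have \<omega>: "\<omega> \<in> space M" using n0[of n0] by simp
        have "sets (Z t \<omega>) = sets borel" using assms(5) t \<omega> by (auto simp: scbm_def)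
        moreover have "g t \<le> g (2 ^ Suc n)" using m n t by (intro mono_onD[OF assms(7)]) auto
        ultimately have "emeasure (Z t \<omega>) {- g t..g t} \<le> emeasure (Z t \<omega>) {- g (2 ^ Suc n)..g (2 ^ Suc n)}"
          by (intro emeasure_mono) auto
        also have "\<dots> = 0" by (rule E_zero[OF n0[OF n(2)] tn])
        finally show False using t by simp
      qed
    qed
  qed
qed

end
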